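(* Let $k$ be an algebraically closed field of characteristic $p>0$, and let $k_{add}$ denote the additive group of $k$, viewed as a linear algebraic group over $k$. Then $\rho(k_{add})=\infty$.
   Context: Let $G$ be a linear algebraic group over the algebraically closed field $k$. $G$-varieties here are irreducible algebraic varieties over $k$ on which $G$ acts morphically. $k(Y)$ is the field of rational functions on $Y$, and $k(Y)^G$ the subfield of $G$-invariants. For a $G$-variety $Y$, a subset $S\subset k(Y)^G$ separates orbits in a subset $U\subseteq Y$ if for any $x,y\in U$ with $G\cdot x\neq G\cdot y$ there exists $f\in S$ defined both at $x$ and at $y$ such that $f(x)\neq f(y)$. $S$ separates orbits in general position (in $Y$) if there is a dense open subset $U$ of $Y$ such that $S$ separates orbits in $U$. For a product $X=\prod_{i=1}^m X_i$ of $G$-varieties, with the diagonal action, and $I\subseteq\{1,\ldots,m\}$, put $X_I:=\prod_{i\in I}X_i$; the projection $X\to X_I$ identifies $k(X_I)$ with a subfield of $k(X)$. Denote by $\rho(G,X)$ the minimal natural number $r$ such that the union of the subfields $k(X_I)^G$ with $|I|\leq r$ separates orbits in general position in $X$. Define $\rho(G)$ as the supremum of $\rho(G,X)$ as $X$ ranges over all finite products of $G$-varieties. *)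

theory Defs
  imports
    "HOL-Analysis.Abstract_Topology"
    "HOL-Algebra.Group_Action"
    "HOL-Computational_Algebra.Polynomial"
    "HOL-Library.Extended_Nat"
begin

section \<open>Spaces with functions\<close>

text \<open>
  Varieties are treated classically, over an algebraically closed field \<open>'k\<close>: a variety is a
  topological space of (closed) points together with its sheaf of regular \<open>'k\<close>-valued functions.
  An element \<open>f \<in> regular X U\<close> is a total function of which only the values on \<open>U\<close> matter.
  The component \<open>regular X U\<close> is meaningful only for \<open>U\<close> open in \<open>zariski X\<close>.
\<close>

record ('a, 'k) fun_space =
  zariski :: "'a topology"
  regular :: "'a set \<Rightarrow> ('a \<Rightarrow> 'k) set"

abbreviation points :: "('a, 'k) fun_space \<Rightarrow> 'a set" where
  "points X \<equiv> topspace (zariski X)"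

text \<open>The \<open>'k\<close>-algebra of functions generated by \<open>S\<close>.\<close>

inductive_set algebra_hull :: "('a \<Rightarrow> 'k::field) set \<Rightarrow> ('a \<Rightarrow> 'k) set"
  for S :: "('a \<Rightarrow> 'k) set" where
  const: "(\<lambda>_. c) \<in> algebra_hull S"
| base: "f \<in> S \<Longrightarrow> f \<in> algebra_hull S"
| add: "f \<in> algebra_hull S \<Longrightarrow> g \<in> algebra_hull S \<Longrightarrow> (\<lambda>x. f x + g x) \<in> algebra_hull S"
| mult: "f \<in> algebra_hull S \<Longrightarrow> g \<in> algebra_hull S \<Longrightarrow> (\<lambda>x. f x * g x) \<in> algebra_hull S"

text \<open>The regular functions form a sheaf of \<open>'k\<close>-algebras of \<open>'k\<close>-valued functions.\<close>

definition space_with_functions :: "('a, 'k::field) fun_space \<Rightarrow> bool" where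
  "space_with_functions X \<longleftrightarrow>
     (\<forall>U f g. openin (zariski X) U \<longrightarrow> f \<in> regular X U \<longrightarrow> (\<forall>x\<in>U. g x = f x) \<longrightarrow> g \<in> regular X U) \<and>
     (\<forall>U. openin (zariski X) U \<longrightarrow> algebra_hull (regular X U) \<subseteq> regular X U) \<and>
     (\<forall>U V. openin (zariski X) U \<longrightarrow> openin (zariski X) V \<longrightarrow> V \<subseteq> U \<longrightarrow>
        regular X U \<subseteq> regular X V) \<and>
     (\<forall>\<U> f. (\<forall>U\<in>\<U>. openin (zariski X) U \<and> f \<in> regular X U) \<longrightarrow> f \<in> regular X (\<Union>\<U>))"

definition is_morphism ::
  "('a, 'k::field) fun_space \<Rightarrow> ('b, 'k) fun_space \<Rightarrow> ('a \<Rightarrow> 'b) \<Rightarrow> bool" where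
  "is_morphism X Y h \<longleftrightarrow>
     continuous_map (zariski X) (zariski Y) h \<and>
     (\<forall>V f. openin (zariski Y) V \<longrightarrow> f \<in> regular Y V \<longrightarrow>
        (\<lambda>x. f (h x)) \<in> regular X {x \<in> points X. h x \<in> V})"

definition isomorphic_spaces ::
  "('a, 'k::field) fun_space \<Rightarrow> ('b, 'k) fun_space \<Rightarrow> bool" where
  "isomorphic_spaces X Y \<longleftrightarrow>
     (\<exists>h h'. is_morphism X Y h \<and> is_morphism Y X h' \<and>
        (\<forall>x\<in>points X. h' (h x) = x) \<and> (\<forall>y\<in>points Y. h (h' y) = y))"

text \<open>
  \<open>C\<close> is a collection of pairs \<open>(W, A)\<close>, where \<open>A\<close> is an algebra of functions on the set \<open>W\<close>.
  The space on the union of the sets \<open>W\<close> has the loci \<open>h \<noteq> 0\<close> in \<open>W\<close>, with \<open>h \<in> A\<close>, as basic open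
  sets, and its regular functions are those that are locally quotients of elements of some \<open>A\<close>.
\<close>

definition fraction_space :: "('a set \<times> ('a \<Rightarrow> 'k::field) set) set \<Rightarrow> ('a, 'k) fun_space" where
  "fraction_space C =
     \<lparr>zariski = topology_generated_by {{x \<in> W. h x \<noteq> 0} | W A h. (W, A) \<in> C \<and> h \<in> A},
      regular = (\<lambda>U. {f. \<forall>x\<in>U. \<exists>(W, A)\<in>C. \<exists>a\<in>A. \<exists>b\<in>A.
        x \<in> W \<and> b x \<noteq> 0 \<and> (\<forall>y\<in>U \<inter> W. b y \<noteq> 0 \<longrightarrow> f y = a y / b y)})\<rparr>"

section \<open>Varieties\<close>

text \<open>
  Affine \<open>n\<close>-space consists of the functions in \<open>{..<n} \<rightarrow>\<^sub>E UNIV\<close>, i.e. those that are \<open>undefined\<close>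
  outside \<open>{..<n}\<close>.
\<close>

definition polynomial_functions :: "nat \<Rightarrow> ((nat \<Rightarrow> 'k::field) \<Rightarrow> 'k) set" where
  "polynomial_functions n = algebra_hull {\<lambda>x. x i | i. i < n}"

definition algebraic_set :: "nat \<Rightarrow> (nat \<Rightarrow> 'k::field) set \<Rightarrow> bool" where
  "algebraic_set n V \<longleftrightarrow>
     (\<exists>S \<subseteq> polynomial_functions n. V = {x \<in> {..<n} \<rightarrow>\<^sub>E UNIV. \<forall>f\<in>S. f x = 0})"

definition is_affine :: "('a, 'k::field) fun_space \<Rightarrow> bool" where
  "is_affine X \<longleftrightarrow> space_with_functions X \<and>
     (\<exists>n V. algebraic_set n V \<and> isomorphic_spaces X (fraction_space {(V, polynomial_functions n)}))"

definition open_subspace :: "('a, 'k::field) fun_space \<Rightarrow> 'a set \<Rightarrow> ('a, 'k) fun_space" where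
  "open_subspace X U = X\<lparr>zariski := subtopology (zariski X) U\<rparr>"

text \<open>
  The products below are the categorical ones: over products of open sets, the regular functions of
  the factors are pulled back along the projections, and the structure is generated by the algebra
  that these pullbacks generate.
\<close>

definition binary_product ::
  "('a, 'k::field) fun_space \<Rightarrow> ('b, 'k) fun_space \<Rightarrow> ('a \<times> 'b, 'k) fun_space" where
  "binary_product X Y = fraction_space
     {(U \<times> V, algebra_hull ({\<lambda>z. f (fst z) | f. f \<in> regular X U} \<union>
                            {\<lambda>z. g (snd z) | g. g \<in> regular Y V})) | U V.
        openin (zariski X) U \<and> openin (zariski Y) V}"

definition product_space ::
  "'i set \<Rightarrow> ('i \<Rightarrow> ('a, 'k::field) fun_space) \<Rightarrow> ('i \<Rightarrow> 'a, 'k) fun_space" where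
  "product_space I X = fraction_space
     {(\<Pi>\<^sub>E i\<in>I. U i, algebra_hull {\<lambda>x. f (x i) | i f. i \<in> I \<and> f \<in> regular (X i) (U i)}) | U.
        \<forall>i\<in>I. openin (zariski (X i)) (U i)}"

text \<open>Varieties are separated and of finite type; irreducibility is a separate condition.\<close>

definition is_variety :: "('a, 'k::field) fun_space \<Rightarrow> bool" where
  "is_variety X \<longleftrightarrow> space_with_functions X \<and>
     (\<exists>\<U>. finite \<U> \<and> \<Union>\<U> = points X \<and>
        (\<forall>U\<in>\<U>. openin (zariski X) U \<and> is_affine (open_subspace X U))) \<and>
     closedin (zariski (binary_product X X)) {(x, x) | x. x \<in> points X}"

definition irreducible_space :: "('a, 'k::field) fun_space \<Rightarrow> bool" where
  "irreducible_space X \<longleftrightarrow> points X \<noteq> {} \<and>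
     (\<forall>A B. closedin (zariski X) A \<longrightarrow> closedin (zariski X) B \<longrightarrow> A \<union> B = points X \<longrightarrow>
        A = points X \<or> B = points X)"

section \<open>Linear algebraic groups and their actions\<close>

record ('g, 'k) alg_group = "'g monoid" +
  group_space :: "('g, 'k) fun_space"

text \<open>
  A linear algebraic group is an affine variety, possibly reducible, with a compatible group
  structure. The notions below that take a \<open>G\<close> of type \<open>alg_group\<close> are intended for such \<open>G\<close>;
  \<open>additive_group\<close> is one, its underlying variety being the affine line \<open>'k\<close>.
\<close>

definition linear_algebraic_group :: "('g, 'k::field) alg_group \<Rightarrow> bool" where
  "linear_algebraic_group G \<longleftrightarrow> group G \<and> is_affine (group_space G) \<and>
     carrier G = points (group_space G) \<and>
     is_morphism (binary_product (group_space G) (group_space G)) (group_space G)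
       (\<lambda>(g, h). g \<otimes>\<^bsub>G\<^esub> h) \<and>
     is_morphism (group_space G) (group_space G) (\<lambda>g. inv\<^bsub>G\<^esub> g)"

definition additive_group :: "('k::field, 'k) alg_group" where
  "additive_group = \<lparr>carrier = UNIV, monoid.mult = (+), one = 0,
     group_space = fraction_space {(UNIV, algebra_hull {\<lambda>x. x})}\<rparr>"

definition is_G_variety ::
  "('g, 'k::field) alg_group \<Rightarrow> ('a, 'k) fun_space \<Rightarrow> ('g \<Rightarrow> 'a \<Rightarrow> 'a) \<Rightarrow> bool" where
  "is_G_variety G X \<phi> \<longleftrightarrow> is_variety X \<and> irreducible_space X \<and>
     group_action G (points X) \<phi> \<and>
     is_morphism (binary_product (group_space G) X) X (\<lambda>(g, x). \<phi> g x)"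

definition diagonal_action ::
  "'i set \<Rightarrow> ('i \<Rightarrow> ('a, 'k::field) fun_space) \<Rightarrow> ('i \<Rightarrow> 'g \<Rightarrow> 'a \<Rightarrow> 'a) \<Rightarrow>
   'g \<Rightarrow> ('i \<Rightarrow> 'a) \<Rightarrow> ('i \<Rightarrow> 'a)" where
  "diagonal_action I X \<phi> g = (\<lambda>x \<in> points (product_space I X). \<lambda>i\<in>I. \<phi> i g (x i))"

section \<open>Rational functions\<close>

definition rat_representatives :: "('a, 'k::field) fun_space \<Rightarrow> ('a set \<times> ('a \<Rightarrow> 'k)) set" where
  "rat_representatives Y = {(U, f). openin (zariski Y) U \<and> U \<noteq> {} \<and> f \<in> regular Y U}"

definition rat_equiv ::
  "('a, 'k::field) fun_space \<Rightarrow> (('a set \<times> ('a \<Rightarrow> 'k)) \<times> ('a set \<times> ('a \<Rightarrow> 'k))) set" where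
  "rat_equiv Y = {((U, f), (V, g)). (U, f) \<in> rat_representatives Y \<and>
     (V, g) \<in> rat_representatives Y \<and> (\<forall>x\<in>U \<inter> V. f x = g x)}"

text \<open>The underlying set of the function field of an irreducible \<open>Y\<close>.\<close>

definition rational_functions ::
  "('a, 'k::field) fun_space \<Rightarrow> ('a set \<times> ('a \<Rightarrow> 'k)) set set" where
  "rational_functions Y = rat_representatives Y // rat_equiv Y"

definition defined_at :: "('a set \<times> ('a \<Rightarrow> 'k)) set \<Rightarrow> 'a \<Rightarrow> bool" where
  "defined_at F x \<longleftrightarrow> (\<exists>(U, f)\<in>F. x \<in> U)"

definition rat_value :: "('a set \<times> ('a \<Rightarrow> 'k)) set \<Rightarrow> 'a \<Rightarrow> 'k" where
  "rat_value F x = (THE c. \<exists>(U, f)\<in>F. x \<in> U \<and> f x = c)"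

text \<open>Pullback of rational functions along a dominant morphism \<open>h\<close> from \<open>X\<close> to \<open>Y\<close>.\<close>

definition rat_pullback ::
  "('a, 'k::field) fun_space \<Rightarrow> ('a \<Rightarrow> 'b) \<Rightarrow>
   ('b set \<times> ('b \<Rightarrow> 'k)) set \<Rightarrow> ('a set \<times> ('a \<Rightarrow> 'k)) set" where
  "rat_pullback X h F =
     rat_equiv X `` ((\<lambda>(V, f). ({x \<in> points X. h x \<in> V}, \<lambda>x. f (h x))) ` F)"

text \<open>The action on rational functions is \<open>(g \<cdot> f)(y) = f(g\<^sup>-\<^sup>1 \<cdot> y)\<close>.\<close>

definition invariant_rational_functions ::
  "('g, 'k::field) alg_group \<Rightarrow> ('a, 'k) fun_space \<Rightarrow> ('g \<Rightarrow> 'a \<Rightarrow> 'a) \<Rightarrow>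
   ('a set \<times> ('a \<Rightarrow> 'k)) set set" where
  "invariant_rational_functions G Y \<phi> =
     {F \<in> rational_functions Y. \<forall>g\<in>carrier G. rat_pullback Y (\<phi> (inv\<^bsub>G\<^esub> g)) F = F}"

section \<open>Separation of orbits and the invariant rho\<close>

definition separates_orbits_in ::
  "('g, 'k::field) alg_group \<Rightarrow> ('g \<Rightarrow> 'a \<Rightarrow> 'a) \<Rightarrow> ('a set \<times> ('a \<Rightarrow> 'k)) set set \<Rightarrow>
   'a set \<Rightarrow> bool" where
  "separates_orbits_in G \<phi> S U \<longleftrightarrow>
     (\<forall>x\<in>U. \<forall>y\<in>U. orbit G \<phi> x \<noteq> orbit G \<phi> y \<longrightarrow>
        (\<exists>F\<in>S. defined_at F x \<and> defined_at F y \<and> rat_value F x \<noteq> rat_value F y))"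

definition separates_orbits_in_general_position ::
  "('g, 'k::field) alg_group \<Rightarrow> ('a, 'k) fun_space \<Rightarrow> ('g \<Rightarrow> 'a \<Rightarrow> 'a) \<Rightarrow>
   ('a set \<times> ('a \<Rightarrow> 'k)) set set \<Rightarrow> bool" where
  "separates_orbits_in_general_position G Y \<phi> S \<longleftrightarrow>
     (\<exists>U. openin (zariski Y) U \<and> (zariski Y) closure_of U = points Y \<and>
        separates_orbits_in G \<phi> S U)"

text \<open>
  The field \<open>k(X_I)^G\<close>, regarded as a subset of the rational functions on the whole product
  (with index set \<open>J \<supseteq> I\<close>) by pullback along the projection.
\<close>

definition subproduct_invariants ::
  "('g, 'k::field) alg_group \<Rightarrow> 'i set \<Rightarrow> ('i \<Rightarrow> ('a, 'k) fun_space) \<Rightarrow>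
   ('i \<Rightarrow> 'g \<Rightarrow> 'a \<Rightarrow> 'a) \<Rightarrow> 'i set \<Rightarrow> (('i \<Rightarrow> 'a) set \<times> (('i \<Rightarrow> 'a) \<Rightarrow> 'k)) set set" where
  "subproduct_invariants G J X \<phi> I =
     rat_pullback (product_space J X) (\<lambda>x. restrict x I) `
       invariant_rational_functions G (product_space I X) (diagonal_action I X \<phi>)"

text \<open>
  The infimum is a minimum: for \<open>G\<close>-varieties \<open>X i\<close>, the set contains \<open>m\<close> by Rosenlicht's theorem.
\<close>

definition rho_product ::
  "('g, 'k::field) alg_group \<Rightarrow> nat \<Rightarrow> (nat \<Rightarrow> ('a, 'k) fun_space) \<Rightarrow>
   (nat \<Rightarrow> 'g \<Rightarrow> 'a \<Rightarrow> 'a) \<Rightarrow> enat" where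
  "rho_product G m X \<phi> = Inf (enat ` {r.
     separates_orbits_in_general_position G (product_space {1..m} X) (diagonal_action {1..m} X \<phi>)
       (\<Union>I\<in>{I. I \<subseteq> {1..m} \<and> card I \<le> r}. subproduct_invariants G {1..m} X \<phi> I)})"

text \<open>
  The points of the varieties are taken from the type \<open>nat \<Rightarrow> 'k\<close>. This is no loss of generality:
  a variety over the algebraically closed (hence infinite) field \<open>'k\<close> has at most as many points as
  \<open>'k\<close>, so it is isomorphic to one whose points lie in \<open>nat \<Rightarrow> 'k\<close>.
\<close>

definition rho :: "('g, 'k::field) alg_group \<Rightarrow> enat" where
  "rho G = Sup {rho_product G m X \<phi> | m X \<phi>.
     \<forall>i\<in>{1..m}. is_G_variety G (X i :: (nat \<Rightarrow> 'k, 'k) fun_space) (\<phi> i)}"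

end

theory Submission
  imports Defs "HOL-Computational_Algebra.Primes"
begin

text \<open>
  Let \<open>k\<close> act on the affine line by \<open>x \<mapsto> x + l t\<close> for an additive polynomial \<open>l\<close>. Choose additive
  polynomials \<open>l\<^sub>1, \<dots>, l\<^sub>r\<close> and points \<open>b\<^sub>1, \<dots>, b\<^sub>r\<close> with \<open>l\<^sub>i b\<^sub>j = \<delta>\<^sub>i\<^sub>j\<close>, which exist since the Frobenius powers
  provide additive polynomials of arbitrarily large degree, and put \<open>l\<^sub>r\<^sub>+\<^sub>1 = l\<^sub>1 + \<dots> + l\<^sub>r\<close>. The translation
  of the \<open>(r+1)\<close>-dimensional affine space by \<open>d = (0, \<dots>, 0, 1)\<close> agrees on any \<open>r\<close> coordinates with the
  action of some group element (\<open>0\<close> or one of the \<open>b\<^sub>j\<close>), hence preserves all invariants in at most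
  \<open>r\<close> coordinates. It moves every point out of its orbit, because \<open>l\<^sub>1 t = \<dots> = l\<^sub>r t = 0\<close> forces \<open>l\<^sub>r\<^sub>+\<^sub>1 t = 0\<close>.
  By irreducibility every dense open set contains a point together with its translate.
\<close>

text \<open>Positive characteristic enters through the dual points. In characteristic 0 the additive
  polynomials are the multiples \<open>c t\<close>. There \<open>l_1 b_2 = 0\<close> with
  \<open>b_2\<close> nonzero, as \<open>l_2 b_2 = 1\<close> requires, would force
  \<open>l_1 = 0\<close>, so not even two of them have dual points.

  The choice of the last polynomial makes one vector serve every subset. If coordinate
  \<open>j\<close> with \<open>j \<le> r\<close> is left out, some \<open>t\<close> must kill the
  other \<open>l_i\<close> and give the last polynomial the value 1; as the last polynomial is the
  sum, \<open>b_j\<close> does both.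

  The technical obstacle is that an invariant is a class of partially defined functions. The group
  element imitating \<open>d\<close> depends on the chosen coordinates, and invariance under it is a
  pointwise identity only where suitable representatives are defined. The given point may lie
  outside that locus. Values are therefore compared on a nonempty open set first and carried to the
  point by an identity principle on an irreducible space, which requires that loci where regular
  functions differ be open.\<close>

section \<open>Spaces of fractions\<close>

text \<open>\<open>space_with_functions\<close> alone does not make nonvanishing loci open or
  inverses regular. These two properties allow quotients to be pulled back along a map, and they
  yield the identity principle.\<close>

definition locally_invertible :: "('a, 'k::field) fun_space \<Rightarrow> bool" where
  "locally_invertible X \<longleftrightarrow> space_with_functions X \<and>
     (\<forall>U f. openin (zariski X) U \<longrightarrow> f \<in> regular X U \<longrightarrow>
        openin (zariski X) {x \<in> U. f x \<noteq> 0} \<and> (\<lambda>x. 1 / f x) \<in> regular X {x \<in> U. f x \<noteq> 0})"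

lemmas space_with_functionsD =
  space_with_functions_def[THEN iffD1, THEN conjunct1]
  space_with_functions_def[THEN iffD1, THEN conjunct2, THEN conjunct1]
  space_with_functions_def[THEN iffD1, THEN conjunct2, THEN conjunct2, THEN conjunct1]
  space_with_functions_def[THEN iffD1, THEN conjunct2, THEN conjunct2, THEN conjunct2]

lemmas locally_invertibleD =
  locally_invertible_def[THEN iffD1, THEN conjunct1]
  locally_invertible_def[THEN iffD1, THEN conjunct2, rule_format, THEN conjunct1]
  locally_invertible_def[THEN iffD1, THEN conjunct2, rule_format, THEN conjunct2]

section \<open>Closure properties of regular functions\<close>

lemma regular_cong:
  assumes "space_with_functions X" "openin (zariski X) U" "f \<in> regular X U" "\<And>x. x \<in> U \<Longrightarrow> g x = f x"
  shows "g \<in> regular X U"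
  using space_with_functionsD(1)[OF assms(1), rule_format, OF assms(2,3)] assms(4) by blast

lemma regular_mono:
  assumes "space_with_functions X" "openin (zariski X) U" "openin (zariski X) V" "V \<subseteq> U"
    "f \<in> regular X U"
  shows "f \<in> regular X V"
  using space_with_functionsD(3)[OF assms(1), rule_format, OF assms(2-4)] assms(5) by blast

lemma regular_glue:
  assumes "space_with_functions X" "\<And>U. U \<in> \<U> \<Longrightarrow> openin (zariski X) U \<and> f \<in> regular X U"
  shows "f \<in> regular X (\<Union>\<U>)"
  using space_with_functionsD(4)[OF assms(1), rule_format, of \<U> f] assms(2) by blast

lemma algebra_hull_regular:
  assumes "space_with_functions X" "openin (zariski X) U" "f \<in> algebra_hull (regular X U)"
  shows "f \<in> regular X U"
  using space_with_functionsD(2)[OF assms(1), rule_format, OF assms(2)] assms(3) by blast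

lemma regular_const:
  assumes "space_with_functions X" "openin (zariski X) U"
  shows "(\<lambda>_. c) \<in> regular X U"
  by (rule algebra_hull_regular[OF assms algebra_hull.const])

lemma regular_add:
  assumes "space_with_functions X" "openin (zariski X) U" "f \<in> regular X U" "g \<in> regular X U"
  shows "(\<lambda>x. f x + g x) \<in> regular X U"
  by (rule algebra_hull_regular[OF assms(1,2) algebra_hull.add[OF algebra_hull.base algebra_hull.base]]) (fact assms)+

lemma regular_mult:
  assumes "space_with_functions X" "openin (zariski X) U" "f \<in> regular X U" "g \<in> regular X U"
  shows "(\<lambda>x. f x * g x) \<in> regular X U"
  by (rule algebra_hull_regular[OF assms(1,2) algebra_hull.mult[OF algebra_hull.base algebra_hull.base]]) (fact assms)+

lemma regular_diff:
  assumes "space_with_functions X" "openin (zariski X) U" "f \<in> regular X U" "g \<in> regular X U"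
  shows "(\<lambda>x. f x - g x) \<in> regular X U"
  using regular_add[OF assms(1,2,3) regular_mult[OF assms(1,2) regular_const[OF assms(1,2), of "-1"] assms(4)]]
  by simp

text \<open>Reduces regularity of the pullback of a generated algebra to its generators, such as
  coordinate functions.\<close>

lemma regular_algebra_hull_comp:
  assumes "space_with_functions X" "openin (zariski X) U" "a \<in> algebra_hull S"
    "\<And>f. f \<in> S \<Longrightarrow> (\<lambda>x. f (h x)) \<in> regular X U"
  shows "(\<lambda>x. a (h x)) \<in> regular X U"
  using assms(3)
proof induction
  case (const c)
  show ?case by (rule regular_const[OF assms(1,2)])
next
  case (base f)
  then show ?case by (rule assms(4))
next
  case (add f g)
  show ?case by (rule regular_add[OF assms(1,2) add.IH])
next
  case (mult f g)
  show ?case by (rule regular_mult[OF assms(1,2) mult.IH])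
qed

lemma algebra_hull_mono:
  assumes "S \<subseteq> T"
  shows "algebra_hull S \<subseteq> algebra_hull T"
proof
  fix f assume "f \<in> algebra_hull S"
  then show "f \<in> algebra_hull T"
  proof induction
    case (const c)
    show ?case by (rule algebra_hull.const)
  next
    case (base f)
    with assms show ?case by (intro algebra_hull.base) blast
  next
    case (add f g)
    show ?case by (rule algebra_hull.add[OF add.IH])
  next
    case (mult f g)
    show ?case by (rule algebra_hull.mult[OF mult.IH])
  qed
qed

text \<open>These conditions allow fractions from different pairs to be combined: each algebra has
  constants, sums and products, and any two embed into a common one over the intersection of their
  domains, where a common denominator exists.\<close>

definition fraction_system :: "('a set \<times> ('a \<Rightarrow> 'k::field) set) set \<Rightarrow> bool" where
  "fraction_system C \<longleftrightarrow>
     (\<forall>(W, A)\<in>C. \<exists>S. A = algebra_hull S) \<and>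
     (\<forall>(W, A)\<in>C. \<forall>(W', A')\<in>C. \<exists>A''. (W \<inter> W', A'') \<in> C \<and> A \<subseteq> A'' \<and> A' \<subseteq> A'')"

lemma fraction_system_closed:
  assumes "fraction_system C" "(W, A) \<in> C"
  shows "(\<lambda>_. c) \<in> A"
    and "a \<in> A \<Longrightarrow> b \<in> A \<Longrightarrow> (\<lambda>x. a x + b x) \<in> A"
    and "a \<in> A \<Longrightarrow> b \<in> A \<Longrightarrow> (\<lambda>x. a x * b x) \<in> A"
proof -
  obtain S where "A = algebra_hull S"
    using assms unfolding fraction_system_def by auto
  then show "(\<lambda>_. c) \<in> A"
    and "a \<in> A \<Longrightarrow> b \<in> A \<Longrightarrow> (\<lambda>x. a x + b x) \<in> A"
    and "a \<in> A \<Longrightarrow> b \<in> A \<Longrightarrow> (\<lambda>x. a x * b x) \<in> A"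
    by (simp_all add: algebra_hull.const algebra_hull.add algebra_hull.mult)
qed

lemma fraction_system_directed:
  assumes "fraction_system C" "(W, A) \<in> C" "(W', A') \<in> C"
  obtains A'' where "(W \<inter> W', A'') \<in> C" "A \<subseteq> A''" "A' \<subseteq> A''"
  using assms unfolding fraction_system_def by fast

lemma fraction_system_singleton: "fraction_system {(W, algebra_hull S)}"
  unfolding fraction_system_def by auto

lemma openin_fraction_space_basic:
  assumes "(W, A) \<in> C" "h \<in> A"
  shows "openin (zariski (fraction_space C)) {x \<in> W. h x \<noteq> 0}"
  using assms unfolding fraction_space_def by (auto intro!: topology_generated_by_Basis)

lemma openin_fraction_space_domain:
  assumes "fraction_system C" "(W, A) \<in> C"
  shows "openin (zariski (fraction_space C)) W"
  using openin_fraction_space_basic[OF assms(2) fraction_system_closed(1)[OF assms, of 1]] by simp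

lemma points_fraction_space:
  assumes "fraction_system C"
  shows "points (fraction_space C) = \<Union>(fst ` C)"
proof
  have "points (fraction_space C) = \<Union>{{x \<in> W. h x \<noteq> 0} | W A h. (W, A) \<in> C \<and> h \<in> A}"
    unfolding fraction_space_def by simp
  also have "\<dots> \<subseteq> \<Union>(fst ` C)"
  proof
    fix x assume "x \<in> \<Union>{{x \<in> W. h x \<noteq> 0} | W A h. (W, A) \<in> C \<and> h \<in> A}"
    then obtain W A where "(W, A) \<in> C" "x \<in> W" by blast
    then show "x \<in> \<Union>(fst ` C)" by (metis UnionI fst_conv imageI)
  qed
  finally show "points (fraction_space C) \<subseteq> \<Union>(fst ` C)" .
  show "\<Union>(fst ` C) \<subseteq> points (fraction_space C)"
  proof (rule Union_least)
    fix W assume "W \<in> fst ` C"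
    then obtain A where "(W, A) \<in> C" by auto
    then show "W \<subseteq> points (fraction_space C)"
      by (intro openin_subset openin_fraction_space_domain[OF assms])
  qed
qed

text \<open>The generating sets form a basis, not just a subbasis: the loci of \<open>h\<close> and
  \<open>h'\<close> meet in the locus of their product over \<open>W \<inter> W'\<close>.\<close>

lemma openin_fraction_space_iff:
  assumes C: "fraction_system C"
  shows "openin (zariski (fraction_space C)) U \<longleftrightarrow>
    (\<forall>x\<in>U. \<exists>W A h. (W, A) \<in> C \<and> h \<in> A \<and> x \<in> W \<and> h x \<noteq> 0 \<and> {y \<in> W. h y \<noteq> 0} \<subseteq> U)"
    (is "_ \<longleftrightarrow> ?P U")
proof
  let ?S = "{{x \<in> W. h x \<noteq> 0} | W A h. (W, A) \<in> C \<and> h \<in> A}"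
  assume "openin (zariski (fraction_space C)) U"
  then have "generate_topology_on ?S U"
    by (simp add: fraction_space_def openin_topology_generated_by)
  then show "?P U"
  proof induction
    case (Int U V)
    show ?case
    proof
      fix x assume "x \<in> U \<inter> V"
      then have x: "x \<in> U" "x \<in> V" by simp_all
      obtain W A h where 1: "(W, A) \<in> C" "h \<in> A" "x \<in> W" "h x \<noteq> 0" "{y \<in> W. h y \<noteq> 0} \<subseteq> U"
        using bspec[OF Int.IH(1) x(1)] by (elim exE conjE)
      obtain W' A' h' where 2: "(W', A') \<in> C" "h' \<in> A'" "x \<in> W'" "h' x \<noteq> 0"
        "{y \<in> W'. h' y \<noteq> 0} \<subseteq> V"
        using bspec[OF Int.IH(2) x(2)] by (elim exE conjE)
      note * = 1 2
      obtain A'' where A'': "(W \<inter> W', A'') \<in> C" "A \<subseteq> A''" "A' \<subseteq> A''"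
        using fraction_system_directed[OF C *(1) *(6)] .
      have "(\<lambda>x. h x * h' x) \<in> A''"
        using fraction_system_closed(3)[OF C A''(1)] A'' * by blast
      moreover have "{y \<in> W \<inter> W'. h y * h' y \<noteq> 0} \<subseteq> U \<inter> V"
        using * by auto
      ultimately show "\<exists>W A h. (W, A) \<in> C \<and> h \<in> A \<and> x \<in> W \<and> h x \<noteq> 0 \<and> {y \<in> W. h y \<noteq> 0} \<subseteq> U \<inter> V"
        using A''(1) * by (intro exI[of _ "W \<inter> W'"] exI[of _ A''] exI[of _ "\<lambda>x. h x * h' x"]) auto
    qed
  next
    case (UN K)
    show ?case
    proof
      fix x assume "x \<in> \<Union>K"
      then obtain k where k: "k \<in> K" "x \<in> k" by blast
      then obtain W A h where "(W, A) \<in> C \<and> h \<in> A \<and> x \<in> W \<and> h x \<noteq> 0 \<and> {y \<in> W. h y \<noteq> 0} \<subseteq> k"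
        using UN.IH by blast
      then show "\<exists>W A h. (W, A) \<in> C \<and> h \<in> A \<and> x \<in> W \<and> h x \<noteq> 0 \<and> {y \<in> W. h y \<noteq> 0} \<subseteq> \<Union>K"
        using k by blast
    qed
  qed blast+
next
  assume P: "?P U"
  show "openin (zariski (fraction_space C)) U"
  proof (subst openin_subopen, intro ballI)
    fix x assume "x \<in> U"
    with P obtain W A h where "(W, A) \<in> C" "h \<in> A" "x \<in> W" "h x \<noteq> 0" "{y \<in> W. h y \<noteq> 0} \<subseteq> U"
      by blast
    then show "\<exists>T. openin (zariski (fraction_space C)) T \<and> x \<in> T \<and> T \<subseteq> U"
      by (intro exI[of _ "{y \<in> W. h y \<noteq> 0}"]) (auto intro: openin_fraction_space_basic)
  qed
qed

lemma regular_fraction_space_iff: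
  "f \<in> regular (fraction_space C) U \<longleftrightarrow> (\<forall>x\<in>U. \<exists>W A a b. (W, A) \<in> C \<and> a \<in> A \<and> b \<in> A \<and>
     x \<in> W \<and> b x \<noteq> 0 \<and> (\<forall>y\<in>U \<inter> W. b y \<noteq> 0 \<longrightarrow> f y = a y / b y))"
  unfolding fraction_space_def by (simp add: Bex_def) (intro ball_cong refl; blast)

lemma regular_fraction_spaceE:
  assumes "f \<in> regular (fraction_space C) U" "x \<in> U"
  obtains W A a b where "(W, A) \<in> C" "a \<in> A" "b \<in> A" "x \<in> W" "b x \<noteq> 0"
    "\<forall>y\<in>U \<inter> W. b y \<noteq> 0 \<longrightarrow> f y = a y / b y"
  using bspec[OF assms(1)[unfolded regular_fraction_space_iff] assms(2)] by blast

lemma regular_fraction_spaceI: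
  assumes "\<And>x. x \<in> U \<Longrightarrow> \<exists>W A a b. (W, A) \<in> C \<and> a \<in> A \<and> b \<in> A \<and>
     x \<in> W \<and> b x \<noteq> 0 \<and> (\<forall>y\<in>U \<inter> W. b y \<noteq> 0 \<longrightarrow> f y = a y / b y)"
  shows "f \<in> regular (fraction_space C) U"
  unfolding regular_fraction_space_iff by (intro ballI assms)

lemma regular_fraction_space_base:
  assumes "fraction_system C" "(W, A) \<in> C" "a \<in> A"
  shows "a \<in> regular (fraction_space C) W"
proof (rule regular_fraction_spaceI)
  fix x assume "x \<in> W"
  then show "\<exists>W' A a' b. (W', A) \<in> C \<and> a' \<in> A \<and> b \<in> A \<and>
     x \<in> W' \<and> b x \<noteq> 0 \<and> (\<forall>y\<in>W \<inter> W'. b y \<noteq> 0 \<longrightarrow> a y = a' y / b y)"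
    using assms fraction_system_closed(1)[OF assms(1,2), of 1]
    by (intro exI[of _ W] exI[of _ A] exI[of _ a] exI[of _ "\<lambda>_. 1"]) auto
qed

lemma fraction_space_regular_algebra:
  fixes C :: "('a set \<times> ('a \<Rightarrow> 'k::field) set) set"
  assumes C: "fraction_system C" and U: "openin (zariski (fraction_space C)) U"
    and f: "f \<in> algebra_hull (regular (fraction_space C) U)"
  shows "f \<in> regular (fraction_space C) U"
  using f
proof induction
  case (const c)
  show ?case
  proof (rule regular_fraction_spaceI)
    fix x assume "x \<in> U"
    then obtain W A where "(W, A) \<in> C" "x \<in> W"
      using openin_subset[OF U] points_fraction_space[OF C] by fastforce
    then show "\<exists>W A a b. (W, A) \<in> C \<and> a \<in> A \<and> b \<in> A \<and>
     x \<in> W \<and> b x \<noteq> 0 \<and> (\<forall>y\<in>U \<inter> W. b y \<noteq> 0 \<longrightarrow> c = a y / b y)"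
      using fraction_system_closed(1)[OF C]
      by (intro exI[of _ W] exI[of _ A] exI[of _ "\<lambda>_. c"] exI[of _ "\<lambda>_. 1"]) auto
  qed
next
  case (base f)
  then show ?case .
next
  case (add f g)
  show ?case
  proof (rule regular_fraction_spaceI)
    fix x assume x: "x \<in> U"
    obtain W A a b where 1: "(W, A) \<in> C" "a \<in> A" "b \<in> A" "x \<in> W" "b x \<noteq> 0"
      "\<forall>y\<in>U \<inter> W. b y \<noteq> 0 \<longrightarrow> f y = a y / b y"
      using regular_fraction_spaceE[OF add.IH(1) x] .
    obtain W' A' a' b' where 2: "(W', A') \<in> C" "a' \<in> A'" "b' \<in> A'" "x \<in> W'" "b' x \<noteq> 0"
      "\<forall>y\<in>U \<inter> W'. b' y \<noteq> 0 \<longrightarrow> g y = a' y / b' y"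
      using regular_fraction_spaceE[OF add.IH(2) x] .
    obtain A'' where A'': "(W \<inter> W', A'') \<in> C" "A \<subseteq> A''" "A' \<subseteq> A''"
      using fraction_system_directed[OF C 1(1) 2(1)] .
    have "(\<lambda>x. a x * b' x + a' x * b x) \<in> A''" "(\<lambda>x. b x * b' x) \<in> A''"
      using 1 2 A'' by (auto intro!: fraction_system_closed(2,3)[OF C A''(1)])
    then show "\<exists>W A a b. (W, A) \<in> C \<and> a \<in> A \<and> b \<in> A \<and>
     x \<in> W \<and> b x \<noteq> 0 \<and> (\<forall>y\<in>U \<inter> W. b y \<noteq> 0 \<longrightarrow> f y + g y = a y / b y)"
      using 1 2 A''(1)
      by (intro exI[of _ "W \<inter> W'"] exI[of _ A''] exI[of _ "\<lambda>x. a x * b' x + a' x * b x"]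
           exI[of _ "\<lambda>x. b x * b' x"]) (auto simp: field_simps)
  qed
next
  case (mult f g)
  show ?case
  proof (rule regular_fraction_spaceI)
    fix x assume x: "x \<in> U"
    obtain W A a b where 1: "(W, A) \<in> C" "a \<in> A" "b \<in> A" "x \<in> W" "b x \<noteq> 0"
      "\<forall>y\<in>U \<inter> W. b y \<noteq> 0 \<longrightarrow> f y = a y / b y"
      using regular_fraction_spaceE[OF mult.IH(1) x] .
    obtain W' A' a' b' where 2: "(W', A') \<in> C" "a' \<in> A'" "b' \<in> A'" "x \<in> W'" "b' x \<noteq> 0"
      "\<forall>y\<in>U \<inter> W'. b' y \<noteq> 0 \<longrightarrow> g y = a' y / b' y"
      using regular_fraction_spaceE[OF mult.IH(2) x] .
    obtain A'' where A'': "(W \<inter> W', A'') \<in> C" "A \<subseteq> A''" "A' \<subseteq> A''"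
      using fraction_system_directed[OF C 1(1) 2(1)] .
    have "(\<lambda>x. a x * a' x) \<in> A''" "(\<lambda>x. b x * b' x) \<in> A''"
      using 1 2 A'' by (auto intro!: fraction_system_closed(2,3)[OF C A''(1)])
    then show "\<exists>W A a b. (W, A) \<in> C \<and> a \<in> A \<and> b \<in> A \<and>
     x \<in> W \<and> b x \<noteq> 0 \<and> (\<forall>y\<in>U \<inter> W. b y \<noteq> 0 \<longrightarrow> f y * g y = a y / b y)"
      using 1 2 A''(1)
      by (intro exI[of _ "W \<inter> W'"] exI[of _ A''] exI[of _ "\<lambda>x. a x * a' x"]
           exI[of _ "\<lambda>x. b x * b' x"]) auto
  qed
qed

text \<open>A fraction \<open>a / b\<close> representing \<open>f\<close> on one member
  \<open>U\<close> may fail elsewhere in the union, although its domain \<open>W\<close> reaches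
  there. Expanding by a function \<open>h\<close> whose nonvanishing locus lies in \<open>U\<close>
  shrinks the locus of the denominator into \<open>U\<close>.\<close>

lemma fraction_space_regular_glue:
  fixes C :: "('a set \<times> ('a \<Rightarrow> 'k::field) set) set"
  assumes C: "fraction_system C"
    and f: "\<And>U. U \<in> \<U> \<Longrightarrow> openin (zariski (fraction_space C)) U \<and> f \<in> regular (fraction_space C) U"
  shows "f \<in> regular (fraction_space C) (\<Union>\<U>)"
proof (rule regular_fraction_spaceI)
  fix x assume "x \<in> \<Union>\<U>"
  then obtain U where U: "U \<in> \<U>" "x \<in> U" by blast
  obtain W A a b where 1: "(W, A) \<in> C" "a \<in> A" "b \<in> A" "x \<in> W" "b x \<noteq> 0"
    "\<forall>y\<in>U \<inter> W. b y \<noteq> 0 \<longrightarrow> f y = a y / b y"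
    using regular_fraction_spaceE[OF f[OF U(1), THEN conjunct2] U(2)] .
  obtain W' A' h where 2: "(W', A') \<in> C" "h \<in> A'" "x \<in> W'" "h x \<noteq> 0" "{y \<in> W'. h y \<noteq> 0} \<subseteq> U"
    using f[OF U(1)] U(2) unfolding openin_fraction_space_iff[OF C] by blast
  obtain A'' where A'': "(W \<inter> W', A'') \<in> C" "A \<subseteq> A''" "A' \<subseteq> A''"
    using fraction_system_directed[OF C 1(1) 2(1)] .
  have "(\<lambda>x. a x * h x) \<in> A''" "(\<lambda>x. b x * h x) \<in> A''"
    using 1 2 A'' by (auto intro!: fraction_system_closed(2,3)[OF C A''(1)])
  then show "\<exists>W A a b. (W, A) \<in> C \<and> a \<in> A \<and> b \<in> A \<and>
     x \<in> W \<and> b x \<noteq> 0 \<and> (\<forall>y\<in>\<Union>\<U> \<inter> W. b y \<noteq> 0 \<longrightarrow> f y = a y / b y)"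
    using 1 2 A''(1)
    by (intro exI[of _ "W \<inter> W'"] exI[of _ A''] exI[of _ "\<lambda>x. a x * h x"]
         exI[of _ "\<lambda>x. b x * h x"]) auto
qed

lemma space_with_functions_fraction_space:
  fixes C :: "('a set \<times> ('a \<Rightarrow> 'k::field) set) set"
  assumes C: "fraction_system C"
  shows "space_with_functions (fraction_space C)"
  unfolding space_with_functions_def
proof (intro conjI allI impI)
  fix U f and g :: "'a \<Rightarrow> 'k" assume *: "f \<in> regular (fraction_space C) U" "\<forall>x\<in>U. g x = f x"
  show "g \<in> regular (fraction_space C) U"
    using * unfolding regular_fraction_space_iff by simp
next
  fix U assume "openin (zariski (fraction_space C)) U"
  then show "algebra_hull (regular (fraction_space C) U) \<subseteq> regular (fraction_space C) U"
    using fraction_space_regular_algebra[OF C] by (intro subsetI)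
next
  fix U V :: "'a set" assume *: "V \<subseteq> U"
  show "regular (fraction_space C) U \<subseteq> regular (fraction_space C) V"
  proof (intro subsetI regular_fraction_spaceI)
    fix f x assume f: "f \<in> regular (fraction_space C) U" and x: "x \<in> V"
    have xU: "x \<in> U" using x * by blast
    obtain W A a b where 1: "(W, A) \<in> C" "a \<in> A" "b \<in> A" "x \<in> W" "b x \<noteq> 0"
      "\<forall>y\<in>U \<inter> W. b y \<noteq> 0 \<longrightarrow> f y = a y / b y"
      using regular_fraction_spaceE[OF f xU] .
    then show "\<exists>W A a b. (W, A) \<in> C \<and> a \<in> A \<and> b \<in> A \<and>
       x \<in> W \<and> b x \<noteq> 0 \<and> (\<forall>y\<in>V \<inter> W. b y \<noteq> 0 \<longrightarrow> f y = a y / b y)"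
      using *
      by (intro exI[of _ W] exI[of _ A] exI[of _ a] exI[of _ b]) auto
  qed
next
  fix \<U> f
  assume "\<forall>U\<in>\<U>. openin (zariski (fraction_space C)) U \<and> f \<in> regular (fraction_space C) U"
  then show "f \<in> regular (fraction_space C) (\<Union>\<U>)"
    by (intro fraction_space_regular_glue[OF C]) simp
qed

lemma locally_invertible_fraction_space:
  fixes C :: "('a set \<times> ('a \<Rightarrow> 'k::field) set) set"
  assumes C: "fraction_system C"
  shows "locally_invertible (fraction_space C)"
  unfolding locally_invertible_def
proof (intro conjI allI impI)
  show "space_with_functions (fraction_space C)"
    by (rule space_with_functions_fraction_space[OF C])
  fix U f assume U: "openin (zariski (fraction_space C)) U" and f: "f \<in> regular (fraction_space C) U"
  show "openin (zariski (fraction_space C)) {x \<in> U. f x \<noteq> 0}"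
  proof (subst openin_subopen, intro ballI)
    fix x assume x: "x \<in> {x \<in> U. f x \<noteq> 0}"
    then have xU: "x \<in> U" by simp
    obtain W A a b where 1: "(W, A) \<in> C" "a \<in> A" "b \<in> A" "x \<in> W" "b x \<noteq> 0"
      "\<forall>y\<in>U \<inter> W. b y \<noteq> 0 \<longrightarrow> f y = a y / b y"
      using regular_fraction_spaceE[OF f xU] .
    \<comment> \<open>Where \<open>a * b\<close> is nonzero, the fraction is valid because of
      \<open>b\<close>, and its value is nonzero because of \<open>a\<close>.\<close>
    have "(\<lambda>x. a x * b x) \<in> A"
      by (rule fraction_system_closed(3)[OF C 1(1-3)])
    then have "openin (zariski (fraction_space C)) (U \<inter> {y \<in> W. a y * b y \<noteq> 0})"
      by (rule openin_Int[OF U openin_fraction_space_basic[OF 1(1)]])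
    moreover have "a x \<noteq> 0"
      using 1 x by auto
    ultimately show "\<exists>T. openin (zariski (fraction_space C)) T \<and> x \<in> T \<and> T \<subseteq> {x \<in> U. f x \<noteq> 0}"
      using 1 x by (intro exI[of _ "U \<inter> {y \<in> W. a y * b y \<noteq> 0}"]) auto
  qed
  show "(\<lambda>x. 1 / f x) \<in> regular (fraction_space C) {x \<in> U. f x \<noteq> 0}"
  proof (rule regular_fraction_spaceI)
    fix x assume x: "x \<in> {x \<in> U. f x \<noteq> 0}"
    then have xU: "x \<in> U" by simp
    obtain W A a b where 1: "(W, A) \<in> C" "a \<in> A" "b \<in> A" "x \<in> W" "b x \<noteq> 0"
      "\<forall>y\<in>U \<inter> W. b y \<noteq> 0 \<longrightarrow> f y = a y / b y"
      using regular_fraction_spaceE[OF f xU] .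
    \<comment> \<open>The inverse is written with denominator \<open>a * b\<close>, not
      \<open>a\<close>: at a zero of \<open>b\<close> nothing is known about \<open>f\<close>, so
      the new denominator has to vanish there.\<close>
    have "(\<lambda>x. b x * b x) \<in> A" "(\<lambda>x. a x * b x) \<in> A"
      by (rule fraction_system_closed(3)[OF C 1(1)] 1)+
    moreover have "a x \<noteq> 0"
      using 1 x by auto
    ultimately show "\<exists>W A a b. (W, A) \<in> C \<and> a \<in> A \<and> b \<in> A \<and> x \<in> W \<and> b x \<noteq> 0 \<and>
        (\<forall>y\<in>{x \<in> U. f x \<noteq> 0} \<inter> W. b y \<noteq> 0 \<longrightarrow> 1 / f y = a y / b y)"
      using 1 by (intro exI[of _ W] exI[of _ A] exI[of _ "\<lambda>x. b x * b x"] exI[of _ "\<lambda>x. a x * b x"]) auto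
  qed
qed

section \<open>Morphisms and products\<close>

lemma openin_morphism_preimage:
  assumes "is_morphism X Y h" "openin (zariski Y) V"
  shows "openin (zariski X) {x \<in> points X. h x \<in> V}"
  using assms(1)[unfolded is_morphism_def, THEN conjunct1] assms(2)
  by (rule openin_continuous_map_preimage)

lemma regular_morphism_preimage:
  assumes "is_morphism X Y h" "openin (zariski Y) V" "f \<in> regular Y V"
  shows "(\<lambda>x. f (h x)) \<in> regular X {x \<in> points X. h x \<in> V}"
  using assms(1)[unfolded is_morphism_def, THEN conjunct2, rule_format, OF assms(2,3)] .

lemma morphism_in_points:
  assumes "is_morphism X Y h" "x \<in> points X"
  shows "h x \<in> points Y"
  using assms(1)[unfolded is_morphism_def, THEN conjunct1] assms(2)
  unfolding continuous_map_def by blast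

text \<open>A map into a space of fractions can be tested on the defining pairs. Local invertibility
  of the source then supplies the preimages of basic open sets and the pullbacks of
  quotients.\<close>

lemma is_morphism_fraction_space:
  fixes C :: "('a set \<times> ('a \<Rightarrow> 'k::field) set) set" and Z :: "('z, 'k) fun_space"
  assumes Z: "locally_invertible Z" and C: "fraction_system C"
    and h: "\<And>z. z \<in> points Z \<Longrightarrow> h z \<in> points (fraction_space C)"
    and W: "\<And>W A. (W, A) \<in> C \<Longrightarrow> openin (zariski Z) {z \<in> points Z. h z \<in> W}"
    and A: "\<And>W A a. (W, A) \<in> C \<Longrightarrow> a \<in> A \<Longrightarrow> (\<lambda>z. a (h z)) \<in> regular Z {z \<in> points Z. h z \<in> W}"
  shows "is_morphism Z (fraction_space C) h"
proof -
  note swf = locally_invertibleD(1)[OF Z] and inv = locally_invertibleD(2,3)[OF Z]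
  have pre: "openin (zariski Z) {z \<in> points Z. h z \<in> U}" if U: "openin (zariski (fraction_space C)) U" for U
  proof (subst openin_subopen, intro ballI)
    fix z assume z: "z \<in> {z \<in> points Z. h z \<in> U}"
    then obtain V B b where *: "(V, B) \<in> C" "b \<in> B" "h z \<in> V" "b (h z) \<noteq> 0" "{y \<in> V. b y \<noteq> 0} \<subseteq> U"
      using U unfolding openin_fraction_space_iff[OF C] by blast
    have "openin (zariski Z) {x \<in> {z \<in> points Z. h z \<in> V}. b (h x) \<noteq> 0}"
      by (rule inv(1)[OF W[OF *(1)] A[OF *(1,2)]])
    then show "\<exists>T. openin (zariski Z) T \<and> z \<in> T \<and> T \<subseteq> {z \<in> points Z. h z \<in> U}"
      using * z by (intro exI[of _ "{x \<in> {z \<in> points Z. h z \<in> V}. b (h x) \<noteq> 0}"]) auto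
  qed
  have reg: "(\<lambda>z. f (h z)) \<in> regular Z {z \<in> points Z. h z \<in> U}"
    if U: "openin (zariski (fraction_space C)) U" and f: "f \<in> regular (fraction_space C) U" for U f
  proof -
    let ?U = "{z \<in> points Z. h z \<in> U}"
    \<comment> \<open>Regularity is local: it is enough that the open sets on which the pullback is
      regular cover the preimage, since the sheaf property glues them.\<close>
    let ?\<N> = "{N. openin (zariski Z) N \<and> N \<subseteq> ?U \<and> (\<lambda>z. f (h z)) \<in> regular Z N}"
    have "?U \<subseteq> \<Union>?\<N>"
    proof
      fix z assume z: "z \<in> ?U"
      then have zU: "h z \<in> U" by simp
      obtain V B a b where *: "(V, B) \<in> C" "a \<in> B" "b \<in> B" "h z \<in> V" "b (h z) \<noteq> 0"
        "\<forall>y\<in>U \<inter> V. b y \<noteq> 0 \<longrightarrow> f y = a y / b y"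
        using regular_fraction_spaceE[OF f zU] .
      define N where "N = {z \<in> points Z. h z \<in> V}"
      define N' where "N' = {z \<in> N. b (h z) \<noteq> 0}"
      have N: "openin (zariski Z) N" "(\<lambda>z. a (h z)) \<in> regular Z N" "(\<lambda>z. b (h z)) \<in> regular Z N"
        unfolding N_def by (rule W[OF *(1)] A[OF *(1,2)] A[OF *(1,3)])+
      have N': "openin (zariski Z) N'" "(\<lambda>z. 1 / b (h z)) \<in> regular Z N'"
        unfolding N'_def by (rule inv[OF N(1,3)])+
      have int: "openin (zariski Z) (?U \<inter> N')"
        using N'(1) pre[OF U] by blast
      have "(\<lambda>z. a (h z)) \<in> regular Z (?U \<inter> N')"
        by (rule regular_mono[OF swf N(1) int _ N(2)]) (auto simp: N'_def)
      moreover have "(\<lambda>z. 1 / b (h z)) \<in> regular Z (?U \<inter> N')"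
        by (rule regular_mono[OF swf N'(1) int _ N'(2)]) auto
      ultimately have "(\<lambda>z. a (h z) * (1 / b (h z))) \<in> regular Z (?U \<inter> N')"
        by (rule regular_mult[OF swf int])
      then have "(\<lambda>z. f (h z)) \<in> regular Z (?U \<inter> N')"
        by (rule regular_cong[OF swf int]) (use *(6) in \<open>auto simp: N'_def N_def\<close>)
      moreover have "z \<in> ?U \<inter> N'"
        using z * by (auto simp: N'_def N_def)
      ultimately show "z \<in> \<Union>?\<N>"
        using int by blast
    qed
    then have "?U = \<Union>?\<N>" by blast
    moreover have "(\<lambda>z. f (h z)) \<in> regular Z (\<Union>?\<N>)"
      by (rule regular_glue[OF swf]) blast
    ultimately show ?thesis by simp
  qed
  show ?thesis
    unfolding is_morphism_def continuous_map_def
    by (intro conjI allI impI reg) (use h pre in blast)+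
qed

lemma is_morphism_id: "is_morphism X X (\<lambda>x. x)"
proof -
  have "{x \<in> points X. x \<in> V} = V" if "openin (zariski X) V" for V
    using openin_subset[OF that] by blast
  then show ?thesis
    unfolding is_morphism_def by simp
qed

lemma is_morphism_comp:
  assumes f: "is_morphism X Y f" and g: "is_morphism Y Z g"
  shows "is_morphism X Z (\<lambda>x. g (f x))"
proof -
  have *: "{x \<in> points X. f x \<in> {y \<in> points Y. g y \<in> V}} = {x \<in> points X. g (f x) \<in> V}" for V
    using morphism_in_points[OF f] by blast
  have "continuous_map (zariski X) (zariski Z) (g \<circ> f)"
    by (rule continuous_map_compose[OF f[unfolded is_morphism_def, THEN conjunct1]
          g[unfolded is_morphism_def, THEN conjunct1]])
  moreover have "(\<lambda>x. u (g (f x))) \<in> regular X {x \<in> points X. g (f x) \<in> V}"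
    if "openin (zariski Z) V" "u \<in> regular Z V" for V u
    using regular_morphism_preimage[OF f openin_morphism_preimage[OF g that(1)]
        regular_morphism_preimage[OF g that]] unfolding * .
  ultimately show ?thesis
    unfolding is_morphism_def comp_def by (intro conjI allI impI)
qed

lemma fraction_systemI:
  assumes "\<And>W A. (W, A) \<in> C \<Longrightarrow> \<exists>S. A = algebra_hull S"
    and "\<And>W A W' A'. (W, A) \<in> C \<Longrightarrow> (W', A') \<in> C \<Longrightarrow>
      \<exists>A''. (W \<inter> W', A'') \<in> C \<and> A \<subseteq> A'' \<and> A' \<subseteq> A''"
  shows "fraction_system C"
  unfolding fraction_system_def by (intro conjI ballI; clarify; rule assms)

section \<open>Binary and indexed products\<close>

abbreviation binary_product_algebra ::
  "('a, 'k::field) fun_space \<Rightarrow> ('b, 'k) fun_space \<Rightarrow> 'a set \<Rightarrow> 'b set \<Rightarrow> ('a \<times> 'b \<Rightarrow> 'k) set" where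
  "binary_product_algebra X Y U V \<equiv> algebra_hull ({\<lambda>z. f (fst z) | f. f \<in> regular X U} \<union>
     {\<lambda>z. g (snd z) | g. g \<in> regular Y V})"

abbreviation product_algebra ::
  "'i set \<Rightarrow> ('i \<Rightarrow> ('a, 'k::field) fun_space) \<Rightarrow> ('i \<Rightarrow> 'a set) \<Rightarrow> (('i \<Rightarrow> 'a) \<Rightarrow> 'k) set" where
  "product_algebra I X U \<equiv> algebra_hull {\<lambda>x. f (x i) | i f. i \<in> I \<and> f \<in> regular (X i) (U i)}"

text \<open>Boxes are closed under intersection, and restricting regular functions of the factors to
  the smaller sides maps both algebras into the one over the smaller box.\<close>

lemma fraction_system_binary_product:
  fixes X :: "('a, 'k::field) fun_space" and Y :: "('b, 'k) fun_space"
  assumes X: "space_with_functions X" and Y: "space_with_functions Y"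
  shows "fraction_system {(U \<times> V, binary_product_algebra X Y U V) | U V.
    openin (zariski X) U \<and> openin (zariski Y) V}" (is "fraction_system ?C")
proof (rule fraction_systemI)
  fix W A assume "(W, A) \<in> ?C"
  then show "\<exists>S. A = algebra_hull S" by blast
next
  fix W A W' A' assume "(W, A) \<in> ?C" "(W', A') \<in> ?C"
  then obtain U V U' V' where W: "W = U \<times> V" "A = binary_product_algebra X Y U V"
    "W' = U' \<times> V'" "A' = binary_product_algebra X Y U' V'"
    and o: "openin (zariski X) U" "openin (zariski Y) V" "openin (zariski X) U'" "openin (zariski Y) V'"
    by auto
  have "regular X U \<subseteq> regular X (U \<inter> U')" "regular X U' \<subseteq> regular X (U \<inter> U')"
    "regular Y V \<subseteq> regular Y (V \<inter> V')" "regular Y V' \<subseteq> regular Y (V \<inter> V')"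
    using o by (auto elim!: regular_mono[OF X, rotated -1] regular_mono[OF Y, rotated -1])
  then have "A \<subseteq> binary_product_algebra X Y (U \<inter> U') (V \<inter> V')"
    "A' \<subseteq> binary_product_algebra X Y (U \<inter> U') (V \<inter> V')"
    unfolding W by (intro algebra_hull_mono; auto)+
  moreover have "(W \<inter> W', binary_product_algebra X Y (U \<inter> U') (V \<inter> V')) \<in> ?C"
    unfolding W Times_Int_Times using o by blast
  ultimately show "\<exists>A''. (W \<inter> W', A'') \<in> ?C \<and> A \<subseteq> A'' \<and> A' \<subseteq> A''"
    by blast
qed

lemma fraction_system_product_space:
  fixes X :: "'i \<Rightarrow> ('a, 'k::field) fun_space"
  assumes X: "\<And>i. i \<in> I \<Longrightarrow> space_with_functions (X i)"
  shows "fraction_system {(\<Pi>\<^sub>E i\<in>I. U i, product_algebra I X U) | U.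
    \<forall>i\<in>I. openin (zariski (X i)) (U i)}" (is "fraction_system ?C")
proof (rule fraction_systemI)
  fix W A assume "(W, A) \<in> ?C"
  then show "\<exists>S. A = algebra_hull S" by blast
next
  fix W A W' A' assume "(W, A) \<in> ?C" "(W', A') \<in> ?C"
  then obtain U U' where W: "W = PiE I U" "A = product_algebra I X U"
    "W' = PiE I U'" "A' = product_algebra I X U'"
    and o: "\<And>i. i \<in> I \<Longrightarrow> openin (zariski (X i)) (U i)" "\<And>i. i \<in> I \<Longrightarrow> openin (zariski (X i)) (U' i)"
    by auto
  have "f \<in> regular (X i) (U i \<inter> U' i)" if "i \<in> I" "f \<in> regular (X i) (U i)" for i f
    by (rule regular_mono[OF X[OF that(1)] o(1)[OF that(1)] _ _ that(2)]) (use o that in auto)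
  then have "A \<subseteq> product_algebra I X (\<lambda>i. U i \<inter> U' i)"
    unfolding W by (intro algebra_hull_mono) auto
  moreover have "f \<in> regular (X i) (U i \<inter> U' i)" if "i \<in> I" "f \<in> regular (X i) (U' i)" for i f
    by (rule regular_mono[OF X[OF that(1)] o(2)[OF that(1)] _ _ that(2)]) (use o that in auto)
  then have "A' \<subseteq> product_algebra I X (\<lambda>i. U i \<inter> U' i)"
    unfolding W by (intro algebra_hull_mono) auto
  moreover have "(W \<inter> W', product_algebra I X (\<lambda>i. U i \<inter> U' i)) \<in> ?C"
    unfolding W PiE_Int using o by (intro CollectI exI[of _ "\<lambda>i. U i \<inter> U' i"]) auto
  ultimately show "\<exists>A''. (W \<inter> W', A'') \<in> ?C \<and> A \<subseteq> A'' \<and> A' \<subseteq> A''"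
    by blast
qed

lemma points_binary_product:
  assumes "space_with_functions X" "space_with_functions Y"
  shows "points (binary_product X Y) = points X \<times> points Y"
proof -
  have "points (binary_product X Y) = \<Union>{U \<times> V | U V. openin (zariski X) U \<and> openin (zariski Y) V}"
    unfolding binary_product_def points_fraction_space[OF fraction_system_binary_product[OF assms]]
    by (auto simp: image_def) 
  also have "\<dots> = points X \<times> points Y"
    by (auto dest: openin_subset)
  finally show ?thesis .
qed

lemma points_product_space:
  assumes "\<And>i. i \<in> I \<Longrightarrow> space_with_functions (X i)"
  shows "points (product_space I X) = (\<Pi>\<^sub>E i\<in>I. points (X i))"
proof -
  have C: "fraction_system {(PiE I U, product_algebra I X U) | U. \<forall>i\<in>I. openin (zariski (X i)) (U i)}"
    by (rule fraction_system_product_space[OF assms])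
  have "points (product_space I X) = \<Union>{PiE I U | U. \<forall>i\<in>I. openin (zariski (X i)) (U i)}"
    unfolding product_space_def points_fraction_space[OF C]
    by (auto simp: image_def)
  also have "\<dots> = (\<Pi>\<^sub>E i\<in>I. points (X i))"
  proof
    show "\<Union>{PiE I U | U. \<forall>i\<in>I. openin (zariski (X i)) (U i)} \<subseteq> (\<Pi>\<^sub>E i\<in>I. points (X i))"
    proof (rule Union_least)
      fix W assume "W \<in> {PiE I U | U. \<forall>i\<in>I. openin (zariski (X i)) (U i)}"
      then obtain U where "W = PiE I U" "\<And>i. i \<in> I \<Longrightarrow> openin (zariski (X i)) (U i)" by blast
      then show "W \<subseteq> (\<Pi>\<^sub>E i\<in>I. points (X i))"
        by (simp add: PiE_mono openin_subset)
    qed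
    have "(\<Pi>\<^sub>E i\<in>I. points (X i)) \<in> {PiE I U | U. \<forall>i\<in>I. openin (zariski (X i)) (U i)}"
      by (intro CollectI exI[of _ "\<lambda>i. points (X i)"]) simp
    then show "(\<Pi>\<^sub>E i\<in>I. points (X i)) \<subseteq> \<Union>{PiE I U | U. \<forall>i\<in>I. openin (zariski (X i)) (U i)}"
      by (rule Union_upper)
  qed
  finally show ?thesis .
qed

lemma locally_invertible_binary_product:
  assumes "space_with_functions X" "space_with_functions Y"
  shows "locally_invertible (binary_product X Y)"
  unfolding binary_product_def
  by (rule locally_invertible_fraction_space[OF fraction_system_binary_product[OF assms]])

lemma locally_invertible_product_space:
  assumes "\<And>i. i \<in> I \<Longrightarrow> space_with_functions (X i)"
  shows "locally_invertible (product_space I X)"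
  unfolding product_space_def
  by (rule locally_invertible_fraction_space[OF fraction_system_product_space[OF assms]])

lemma regular_fst:
  fixes X :: "('a, 'k::field) fun_space" and Y :: "('b, 'k) fun_space"
  assumes "space_with_functions X" "space_with_functions Y" "f \<in> regular X (points X)"
  shows "(\<lambda>z. f (fst z)) \<in> regular (binary_product X Y) (points X \<times> points Y)"
  unfolding binary_product_def
proof (rule regular_fraction_space_base[OF fraction_system_binary_product[OF assms(1,2)]])
  show "(points X \<times> points Y, binary_product_algebra X Y (points X) (points Y)) \<in>
    {(U \<times> V, binary_product_algebra X Y U V) | U V. openin (zariski X) U \<and> openin (zariski Y) V}"
    by blast
  show "(\<lambda>z. f (fst z)) \<in> binary_product_algebra X Y (points X) (points Y)"
    by (rule algebra_hull.base) (use assms(3) in blast)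
qed

lemma regular_snd:
  fixes X :: "('a, 'k::field) fun_space" and Y :: "('b, 'k) fun_space"
  assumes "space_with_functions X" "space_with_functions Y" "f \<in> regular Y (points Y)"
  shows "(\<lambda>z. f (snd z)) \<in> regular (binary_product X Y) (points X \<times> points Y)"
  unfolding binary_product_def
proof (rule regular_fraction_space_base[OF fraction_system_binary_product[OF assms(1,2)]])
  show "(points X \<times> points Y, binary_product_algebra X Y (points X) (points Y)) \<in>
    {(U \<times> V, binary_product_algebra X Y U V) | U V. openin (zariski X) U \<and> openin (zariski Y) V}"
    by blast
  show "(\<lambda>z. f (snd z)) \<in> binary_product_algebra X Y (points X) (points Y)"
    by (rule algebra_hull.base) (use assms(3) in blast)
qed

text \<open>The existence half of the universal property of the product. Finiteness of
  \<open>I\<close> makes the preimage of a box a finite intersection of open sets.\<close>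

lemma is_morphism_product_space:
  fixes X :: "'i \<Rightarrow> ('a, 'k::field) fun_space" and Z :: "('z, 'k) fun_space"
  assumes "finite I" and Z: "locally_invertible Z" and X: "\<And>i. i \<in> I \<Longrightarrow> space_with_functions (X i)"
    and h: "\<And>i. i \<in> I \<Longrightarrow> is_morphism Z (X i) (h i)"
  shows "is_morphism Z (product_space I X) (\<lambda>z. \<lambda>i\<in>I. h i z)"
proof -
  have pts: "points (product_space I X) = (\<Pi>\<^sub>E i\<in>I. points (X i))"
    by (rule points_product_space[OF X])
  note swf = locally_invertibleD(1)[OF Z]
  have eq: "{z \<in> points Z. (\<lambda>i\<in>I. h i z) \<in> PiE I U} = points Z \<inter> (\<Inter>i\<in>I. {z \<in> points Z. h i z \<in> U i})" for U
    by (auto simp: PiE_iff)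
  have W: "openin (zariski Z) {z \<in> points Z. (\<lambda>i\<in>I. h i z) \<in> PiE I U}"
    if "\<And>i. i \<in> I \<Longrightarrow> openin (zariski (X i)) (U i)" for U
  \<comment> \<open>The empty intersection is \<open>UNIV\<close>, which need not be open; for empty
    \<open>I\<close> the preimage is instead all of \<open>points Z\<close>.\<close>
  proof (cases "I = {}")
    case False
    then have "openin (zariski Z) (\<Inter>i\<in>I. {z \<in> points Z. h i z \<in> U i})"
      using \<open>finite I\<close> that by (intro openin_Inter) (auto intro: openin_morphism_preimage[OF h])
    then show ?thesis
      unfolding eq by (intro openin_Int) auto
  qed (simp add: restrict_def)
  show ?thesis
    unfolding product_space_def
  proof (rule is_morphism_fraction_space[OF Z fraction_system_product_space[OF X]])
    fix z assume "z \<in> points Z"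
    then have "(\<lambda>i\<in>I. h i z) \<in> points (product_space I X)"
      unfolding pts using morphism_in_points[OF h] by auto
    then show "(\<lambda>i\<in>I. h i z) \<in> points (fraction_space {(PiE I U, product_algebra I X U) | U.
        \<forall>i\<in>I. openin (zariski (X i)) (U i)})"
      unfolding product_space_def .
  next
    fix W' A assume "(W', A) \<in> {(PiE I U, product_algebra I X U) | U. \<forall>i\<in>I. openin (zariski (X i)) (U i)}"
    then obtain U where U: "\<And>i. i \<in> I \<Longrightarrow> openin (zariski (X i)) (U i)"
      "W' = PiE I U" "A = product_algebra I X U" by auto
    show "openin (zariski Z) {z \<in> points Z. (\<lambda>i\<in>I. h i z) \<in> W'}"
      unfolding U(2) by (rule W[OF U(1)])
    fix a assume "a \<in> A"
    show "(\<lambda>z. a (\<lambda>i\<in>I. h i z)) \<in> regular Z {z \<in> points Z. (\<lambda>i\<in>I. h i z) \<in> W'}"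
      unfolding U(2)
    proof (rule regular_algebra_hull_comp[OF swf W[OF U(1)] \<open>a \<in> A\<close>[unfolded U(3)]])
      fix g assume "g \<in> {\<lambda>x. f (x i) | i f. i \<in> I \<and> f \<in> regular (X i) (U i)}"
      then obtain i f where g: "g = (\<lambda>x. f (x i))" "i \<in> I" "f \<in> regular (X i) (U i)" by blast
      have "(\<lambda>z. f (h i z)) \<in> regular Z {z \<in> points Z. (\<lambda>i\<in>I. h i z) \<in> PiE I U}"
        by (rule regular_mono[OF swf openin_morphism_preimage[OF h[OF g(2)] U(1)[OF g(2)]] W[OF U(1)]
              _ regular_morphism_preimage[OF h[OF g(2)] U(1)[OF g(2)] g(3)]])
          (use g in \<open>auto simp: PiE_iff\<close>)
      then show "(\<lambda>z. g (\<lambda>i\<in>I. h i z)) \<in> regular Z {z \<in> points Z. (\<lambda>i\<in>I. h i z) \<in> PiE I U}"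
        using g(1,2) by simp
    qed
  qed
qed

text \<open>The preimage of \<open>V\<close> is the box \<open>U V\<close> with side
  \<open>V\<close> at \<open>i\<close> and full sides elsewhere. It is a domain of the fraction
  system, and the pulled-back function is one of the generators over it.\<close>

lemma is_morphism_component:
  fixes X :: "'i \<Rightarrow> ('a, 'k::field) fun_space"
  assumes X: "\<And>i. i \<in> I \<Longrightarrow> space_with_functions (X i)" and i: "i \<in> I"
  shows "is_morphism (product_space I X) (X i) (\<lambda>x. x i)"
proof -
  let ?C = "{(PiE I U, product_algebra I X U) | U. \<forall>i\<in>I. openin (zariski (X i)) (U i)}"
  have C: "fraction_system ?C" by (rule fraction_system_product_space[OF X])
  have pts: "points (product_space I X) = (\<Pi>\<^sub>E i\<in>I. points (X i))"
    by (rule points_product_space[OF X])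
  define U where "U V = (\<lambda>j. if j = i then V else points (X j))" for V
  have eq: "{x \<in> points (product_space I X). x i \<in> V} = PiE I (U V)" if "V \<subseteq> points (X i)" for V
    unfolding pts U_def using i that by (auto simp: PiE_iff extensional_def split: if_splits) (metis subsetD)
  have mem: "(PiE I (U V), product_algebra I X (U V)) \<in> ?C" if "openin (zariski (X i)) V" for V
    by (intro CollectI exI[of _ "U V"] conjI refl) (use that in \<open>simp add: U_def\<close>)
  have "openin (zariski (product_space I X)) {x \<in> points (product_space I X). x i \<in> V}"
    if "openin (zariski (X i)) V" for V
    unfolding eq[OF openin_subset[OF that]] unfolding product_space_def
    by (rule openin_fraction_space_domain[OF C mem[OF that]])
  moreover have "(\<lambda>x. f (x i)) \<in> regular (product_space I X) {x \<in> points (product_space I X). x i \<in> V}"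
    if "openin (zariski (X i)) V" "f \<in> regular (X i) V" for V f
    unfolding eq[OF openin_subset[OF that(1)]] unfolding product_space_def
    by (rule regular_fraction_space_base[OF C mem[OF that(1)] algebra_hull.base])
      (use that(2) i in \<open>auto simp: U_def\<close>)
  moreover have "x i \<in> points (X i)" if "x \<in> points (product_space I X)" for x
    using that i unfolding pts by auto
  ultimately show ?thesis
    unfolding is_morphism_def continuous_map_def by (intro conjI allI impI) blast+
qed

section \<open>Irreducibility\<close>

text \<open>The variety of \<open>additive_group\<close>, which also serves as the parameter line
  for the curves in the irreducibility proofs.\<close>

definition base_line :: "('k::field, 'k) fun_space" where
  "base_line = fraction_space {(UNIV, algebra_hull {\<lambda>x. x})}"

lemma points_base_line [simp]: "points base_line = UNIV"
  unfolding base_line_def points_fraction_space[OF fraction_system_singleton] by simp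

lemma locally_invertible_base_line: "locally_invertible base_line"
  unfolding base_line_def by (rule locally_invertible_fraction_space[OF fraction_system_singleton])

lemma algebra_hull_id_eq_range_poly: "algebra_hull {\<lambda>x. x} = range poly"
proof
  show "algebra_hull {\<lambda>x. x} \<subseteq> range (poly :: 'a poly \<Rightarrow> _)"
  proof
    fix h :: "'a \<Rightarrow> 'a" assume "h \<in> algebra_hull {\<lambda>x. x}"
    then show "h \<in> range poly"
    proof induction
      case (const c)
      have "(\<lambda>_. c) = poly [:c:]" by (simp add: fun_eq_iff)
      then show ?case by (rule range_eqI)
    next
      case (base f)
      then have "f = poly [:0, 1:]" by (simp add: fun_eq_iff)
      then show ?case by (rule range_eqI)
    next
      case (add f g)
      then obtain p q where "f = poly p" "g = poly q" by blast
      then have "(\<lambda>x. f x + g x) = poly (p + q)" by (simp add: fun_eq_iff)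
      then show ?case by (rule range_eqI)
    next
      case (mult f g)
      then obtain p q where "f = poly p" "g = poly q" by blast
      then have "(\<lambda>x. f x * g x) = poly (p * q)" by (simp add: fun_eq_iff)
      then show ?case by (rule range_eqI)
    qed
  qed
  have "poly q \<in> algebra_hull {\<lambda>x. x}" for q :: "'a poly"
  proof (induction q)
    case 0
    then show ?case using algebra_hull.const[of 0] by (simp add: poly_0[abs_def])
  next
    case (pCons a q)
    have "(\<lambda>x. a + x * poly q x) \<in> algebra_hull {\<lambda>x. x}"
      by (rule algebra_hull.add[OF algebra_hull.const algebra_hull.mult[OF algebra_hull.base pCons.IH]]) simp
    moreover have "poly (pCons a q) = (\<lambda>x. a + x * poly q x)" by (simp add: fun_eq_iff)
    ultimately show ?case by simp
  qed
  then show "range poly \<subseteq> algebra_hull {\<lambda>x::'a. x}" by blast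
qed

lemma regular_base_line_poly: "poly q \<in> regular base_line UNIV"
  unfolding base_line_def
  by (rule regular_fraction_space_base[OF fraction_system_singleton, of UNIV])
    (auto simp: algebra_hull_id_eq_range_poly)

text \<open>A nonempty open set contains the nonvanishing locus of a nonzero polynomial, which has
  only finitely many roots.\<close>

lemma finite_Compl_openin_base_line:
  assumes "openin (zariski base_line) U" "U \<noteq> {}"
  shows "finite (- U)"
proof -
  obtain x where "x \<in> U" using assms by blast
  then obtain q where q: "poly q x \<noteq> 0" "{y. poly q y \<noteq> 0} \<subseteq> U"
    using assms(1) unfolding base_line_def openin_fraction_space_iff[OF fraction_system_singleton]
    by (auto simp: algebra_hull_id_eq_range_poly)
  then have "- U \<subseteq> {y. poly q y = 0}" "q \<noteq> 0" by auto
  then show ?thesis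
    using poly_roots_finite finite_subset by blast
qed

text \<open>If \<open>A\<close> and \<open>B\<close> were proper closed sets covering
  \<open>X\<close>, a line from a point outside \<open>A\<close> to a point outside \<open>B\<close>
  would meet both complements. Each complement pulls back to a cofinite set, and the two pullbacks
  are disjoint, which is impossible on an infinite line.\<close>

lemma irreducible_space_if_lines:
  fixes X :: "('a, 'k::field) fun_space"
  assumes "infinite (UNIV :: 'k set)" and "points X \<noteq> {}"
    and lines: "\<And>x y. x \<in> points X \<Longrightarrow> y \<in> points X \<Longrightarrow>
      \<exists>h. is_morphism base_line X h \<and> h 0 = x \<and> h 1 = y"
  shows "irreducible_space X"
  unfolding irreducible_space_def
proof (intro conjI allI impI, fact)
  fix A B
  assume A: "closedin (zariski X) A" and B: "closedin (zariski X) B" and AB: "A \<union> B = points X"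
  show "A = points X \<or> B = points X"
  proof (rule ccontr)
    assume "\<not> (A = points X \<or> B = points X)"
    then obtain x y where xy: "x \<in> points X - A" "y \<in> points X - B"
      using AB by blast
    then obtain h where h: "is_morphism base_line X h" "h 0 = x" "h 1 = y"
      using lines by blast
    have "openin (zariski X) (points X - A)" "openin (zariski X) (points X - B)"
      using A B by (auto simp: closedin_def)
    then have "openin (zariski base_line) {s. h s \<in> points X - A}"
      "openin (zariski base_line) {s. h s \<in> points X - B}"
      using openin_morphism_preimage[OF h(1)] by fastforce+
    moreover have "0 \<in> {s. h s \<in> points X - A}" "1 \<in> {s. h s \<in> points X - B}"
      using h xy by auto
    ultimately have "finite (- {s. h s \<in> points X - A})" "finite (- {s. h s \<in> points X - B})"
      using finite_Compl_openin_base_line by blast+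
    then have "finite (- {s. h s \<in> points X - A} \<union> - {s. h s \<in> points X - B})" by simp
    moreover have "- {s. h s \<in> points X - A} \<union> - {s. h s \<in> points X - B} = UNIV"
      using AB by auto
    ultimately show False
      using assms(1) by metis
  qed
qed

lemma irreducible_space_Int_nonempty:
  assumes X: "irreducible_space X" and U: "openin (zariski X) U" "U \<noteq> {}"
    and V: "openin (zariski X) V" "V \<noteq> {}"
  shows "U \<inter> V \<noteq> {}"
proof
  assume "U \<inter> V = {}"
  then have "(points X - U) \<union> (points X - V) = points X" by blast
  moreover have "closedin (zariski X) (points X - U)" "closedin (zariski X) (points X - V)"
    using U V by auto
  ultimately have "points X - U = points X \<or> points X - V = points X"
    using X unfolding irreducible_space_def by blast
  then show False
    using U V openin_subset by blast
qed

lemma irreducible_space_Inter_nonempty: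
  assumes X: "irreducible_space X" and "finite \<U>"
    and "\<And>U. U \<in> \<U> \<Longrightarrow> openin (zariski X) U \<and> U \<noteq> {}"
  shows "\<exists>x \<in> points X. \<forall>U\<in>\<U>. x \<in> U"
proof -
  \<comment> \<open>Keeping \<open>points X\<close> in the intersection gives the empty family an
    open, nonempty value, from which the induction can start.\<close>
  have "openin (zariski X) (points X \<inter> \<Inter>\<U>) \<and> points X \<inter> \<Inter>\<U> \<noteq> {}"
    using assms(2,3)
  proof (induction)
    case empty
    then show ?case using X unfolding irreducible_space_def by simp
  next
    case (insert U \<U>)
    then have "openin (zariski X) (U \<inter> (points X \<inter> \<Inter>\<U>))" "U \<inter> (points X \<inter> \<Inter>\<U>) \<noteq> {}"
      using irreducible_space_Int_nonempty[OF X, of U "points X \<inter> \<Inter>\<U>"] by auto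
    moreover have "U \<inter> (points X \<inter> \<Inter>\<U>) = points X \<inter> \<Inter>(insert U \<U>)" by blast
    ultimately show ?case by simp
  qed
  then show ?thesis by blast
qed

text \<open>The identity principle: if the open locus in \<open>U\<close> where \<open>f\<close> and
  \<open>g\<close> differ were nonempty, irreducibility would make it meet \<open>V\<close>.\<close>

lemma regular_eq_if_eq_on_open:
  assumes X: "irreducible_space X" "locally_invertible X"
    and U: "openin (zariski X) U" "f \<in> regular X U" "g \<in> regular X U" "x \<in> U"
    and V: "openin (zariski X) V" "V \<noteq> {}" "\<And>y. y \<in> U \<inter> V \<Longrightarrow> f y = g y"
  shows "f x = g x"
proof (rule ccontr)
  assume "f x \<noteq> g x"
  have "openin (zariski X) {y \<in> U. f y - g y \<noteq> 0}"
    by (rule locally_invertibleD(2)[OF X(2) U(1) regular_diff[OF locally_invertibleD(1)[OF X(2)] U(1-3)]])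
  moreover have "{y \<in> U. f y - g y \<noteq> 0} \<noteq> {}"
    using \<open>x \<in> U\<close> \<open>f x \<noteq> g x\<close> by auto
  ultimately have "{y \<in> U. f y - g y \<noteq> 0} \<inter> V \<noteq> {}"
    by (rule irreducible_space_Int_nonempty[OF X(1) _ _ V(1,2)])
  then show False
    using V(3) by auto
qed

section \<open>The affine line with a translation action\<close>

definition line_point :: "'k \<Rightarrow> nat \<Rightarrow> 'k" where
  "line_point c = (\<lambda>_\<in>{..<1}. c)"

text \<open>
  Unlike \<open>base_line\<close>, the variety of the group, this copy of the affine line has its points in
  \<open>nat \<Rightarrow> 'k\<close>, as \<open>rho\<close> demands.
\<close>

definition affine_line :: "(nat \<Rightarrow> 'k::field, 'k) fun_space" where
  "affine_line = fraction_space {({..<1} \<rightarrow>\<^sub>E UNIV, polynomial_functions 1)}"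

lemma line_point_0 [simp]: "line_point c 0 = c"
  by (simp add: line_point_def)

lemma polynomial_functions_1: "polynomial_functions 1 = algebra_hull {\<lambda>x. x 0}"
proof -
  have "{\<lambda>x. x i | i. i < (1::nat)} = {\<lambda>x :: nat \<Rightarrow> 'a. x 0}" by auto
  then show ?thesis unfolding polynomial_functions_def by (rule arg_cong)
qed

lemma fraction_system_affine_line: "fraction_system {({..<1} \<rightarrow>\<^sub>E UNIV, polynomial_functions 1)}"
  unfolding polynomial_functions_def by (rule fraction_system_singleton)

lemma points_affine_line_eq: "points affine_line = {..<1} \<rightarrow>\<^sub>E UNIV"
  unfolding affine_line_def points_fraction_space[OF fraction_system_affine_line] by simp

lemma line_point_in_points [simp]: "line_point c \<in> points affine_line"
  unfolding points_affine_line_eq line_point_def by simp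

lemma line_point_eq: "x \<in> points affine_line \<Longrightarrow> line_point (x 0) = x"
  unfolding points_affine_line_eq line_point_def by (auto simp: fun_eq_iff PiE_iff extensional_def)

lemma affine_line_points_eqI: "x \<in> points affine_line \<Longrightarrow> y \<in> points affine_line \<Longrightarrow> x 0 = y 0 \<Longrightarrow> x = y"
  by (metis line_point_eq)

lemma locally_invertible_affine_line: "locally_invertible affine_line"
  unfolding affine_line_def by (rule locally_invertible_fraction_space[OF fraction_system_affine_line])

lemmas space_with_functions_affine_line = locally_invertibleD(1)[OF locally_invertible_affine_line]

lemma regular_affine_line_coordinate: "(\<lambda>x. x 0) \<in> regular affine_line (points affine_line)"
  unfolding points_affine_line_eq unfolding affine_line_def
  by (rule regular_fraction_space_base[OF fraction_system_affine_line, of "{..<1} \<rightarrow>\<^sub>E UNIV"])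
    (auto simp: polynomial_functions_1[simplified] intro: algebra_hull.base)

text \<open>One coordinate generates the polynomial functions, so morphisms into the affine line
  amount to regular functions on the source.\<close>

lemma is_morphism_affine_line:
  fixes Z :: "('z, 'k::field) fun_space"
  assumes Z: "locally_invertible Z" and h: "\<And>z. z \<in> points Z \<Longrightarrow> h z \<in> points affine_line"
    and reg: "(\<lambda>z. h z 0) \<in> regular Z (points Z)"
  shows "is_morphism Z affine_line h"
proof -
  have eq: "{z \<in> points Z. h z \<in> {..<1} \<rightarrow>\<^sub>E UNIV} = points Z"
    using h unfolding points_affine_line_eq by blast
  show ?thesis
    unfolding affine_line_def
  proof (rule is_morphism_fraction_space[OF Z fraction_system_affine_line])
    show "h z \<in> points (fraction_space {({..<1} \<rightarrow>\<^sub>E UNIV, polynomial_functions 1)})"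
      if "z \<in> points Z" for z
      using h[OF that] unfolding affine_line_def .
  next
    fix W :: "(nat \<Rightarrow> 'k) set" and A :: "((nat \<Rightarrow> 'k) \<Rightarrow> 'k) set"
    assume WA: "(W, A) \<in> {({..<1} \<rightarrow>\<^sub>E UNIV, polynomial_functions 1)}"
    then have W: "{z \<in> points Z. h z \<in> W} = points Z"
      using eq by simp
    show "openin (zariski Z) {z \<in> points Z. h z \<in> W}"
      unfolding W by simp
    fix a assume "a \<in> A"
    then have a: "a \<in> algebra_hull {\<lambda>x. x 0}"
      using WA unfolding polynomial_functions_1 by simp
    show "(\<lambda>z. a (h z)) \<in> regular Z {z \<in> points Z. h z \<in> W}"
      unfolding W
      by (rule regular_algebra_hull_comp[OF locally_invertibleD(1)[OF Z] openin_topspace a])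
        (use reg in simp)
  qed
qed

lemma is_morphism_affine_line_shift: "is_morphism affine_line affine_line (\<lambda>x. line_point (x 0 + c))"
proof (rule is_morphism_affine_line[OF locally_invertible_affine_line])
  show "(\<lambda>x. line_point (x 0 + c) 0) \<in> regular affine_line (points affine_line)"
    unfolding line_point_0
    by (rule regular_add[OF space_with_functions_affine_line openin_topspace
          regular_affine_line_coordinate regular_const[OF space_with_functions_affine_line openin_topspace]])
qed simp

lemma affine_line_lines:
  assumes "x \<in> points affine_line" "y \<in> points affine_line"
  shows "\<exists>h. is_morphism base_line affine_line h \<and> h 0 = x \<and> h 1 = y"
proof (intro exI conjI)
  \<comment> \<open>The straight line \<open>x + s (y - x)\<close> through the two points.\<close>
  let ?h = "\<lambda>s. line_point (poly [:x 0, y 0 - x 0:] s)"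
  show "is_morphism base_line affine_line ?h"
  proof (rule is_morphism_affine_line[OF locally_invertible_base_line])
    show "(\<lambda>s. line_point (poly [:x 0, y 0 - x 0:] s) 0) \<in> regular base_line (points base_line)"
      unfolding line_point_0 points_base_line by (rule regular_base_line_poly)
  qed (rule line_point_in_points)
  show "?h 0 = x" "?h 1 = y"
    using assms by (simp_all add: line_point_eq)
qed

lemma irreducible_affine_line:
  assumes "infinite (UNIV :: 'k::field set)"
  shows "irreducible_space (affine_line :: (nat \<Rightarrow> 'k, 'k) fun_space)"
  by (rule irreducible_space_if_lines[OF assms _ affine_line_lines]) (use line_point_in_points in blast)+

lemma is_affine_affine_line: "is_affine affine_line"
  unfolding is_affine_def
proof (intro conjI exI)
  show "space_with_functions affine_line" by (rule space_with_functions_affine_line)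
  show "algebraic_set 1 ({..<1} \<rightarrow>\<^sub>E UNIV)"
    unfolding algebraic_set_def by (intro exI[of _ "{}"]) simp
  show "isomorphic_spaces affine_line (fraction_space {({..<1} \<rightarrow>\<^sub>E UNIV, polynomial_functions 1)})"
    unfolding affine_line_def[symmetric] isomorphic_spaces_def
    by (intro exI[of _ "\<lambda>x. x"] conjI is_morphism_id) simp_all
qed

lemma is_variety_affine_line: "is_variety (affine_line :: (nat \<Rightarrow> 'k::field, 'k) fun_space)"
  unfolding is_variety_def
proof (intro conjI)
  let ?L = "affine_line :: (nat \<Rightarrow> 'k, 'k) fun_space"
  note swf = space_with_functions_affine_line
  show "space_with_functions ?L" by (rule swf)
  have "open_subspace ?L (points ?L) = ?L"
    unfolding open_subspace_def by simp
  then show "\<exists>\<U>. finite \<U> \<and> \<Union>\<U> = points ?L \<and>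
      (\<forall>U\<in>\<U>. openin (zariski ?L) U \<and> is_affine (open_subspace ?L U))"
    by (intro exI[of _ "{points ?L}"]) (simp add: is_affine_affine_line)
  let ?P = "binary_product ?L ?L"
  have pts: "points ?P = points ?L \<times> points ?L"
    by (rule points_binary_product[OF swf swf])
  have P: "locally_invertible ?P"
    by (rule locally_invertible_binary_product[OF swf swf])
  have o: "openin (zariski ?P) (points ?L \<times> points ?L)"
    unfolding pts[symmetric] by (rule openin_topspace)
  \<comment> \<open>Separatedness: the complement of the diagonal is where the regular function
    "difference of the coordinates" is nonzero.\<close>
  have "openin (zariski ?P) {z \<in> points ?L \<times> points ?L. fst z 0 - snd z 0 \<noteq> 0}"
    by (rule locally_invertibleD(2)[OF P o regular_diff[OF locally_invertibleD(1)[OF P] o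
          regular_fst[OF swf swf regular_affine_line_coordinate]
          regular_snd[OF swf swf regular_affine_line_coordinate]]])
  moreover have "{z \<in> points ?L \<times> points ?L. fst z 0 - snd z 0 \<noteq> 0} =
      points ?L \<times> points ?L - {(x, x) | x. x \<in> points ?L}"
    by (auto dest: affine_line_points_eqI)
  ultimately show "closedin (zariski ?P) {(x, x) | x. x \<in> points ?L}"
    unfolding closedin_def pts by auto
qed

section \<open>Translation actions of the additive group\<close>

definition additive_poly :: "'k::field poly \<Rightarrow> bool" where
  "additive_poly q \<longleftrightarrow> (\<forall>x y. poly q (x + y) = poly q x + poly q y)"

text \<open>Restricted to the points because \<open>group_action\<close> maps into
  \<open>BijGroup\<close>, whose elements are extensional functions.\<close>

definition translation_action :: "'k::field poly \<Rightarrow> 'k \<Rightarrow> (nat \<Rightarrow> 'k) \<Rightarrow> nat \<Rightarrow> 'k" where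
  "translation_action q t = (\<lambda>x \<in> points affine_line. line_point (x 0 + poly q t))"

lemma carrier_additive_group [simp]: "carrier additive_group = UNIV"
  and mult_additive_group [simp]: "s \<otimes>\<^bsub>additive_group\<^esub> t = s + t"
  and one_additive_group [simp]: "\<one>\<^bsub>additive_group\<^esub> = 0"
  and group_space_additive_group: "group_space additive_group = base_line"
  by (simp_all add: additive_group_def base_line_def)

lemma group_additive_group: "group (additive_group :: ('k::field, 'k) alg_group)"
proof (rule groupI)
  fix x :: 'k assume "x \<in> carrier additive_group"
  show "\<exists>y\<in>carrier additive_group. y \<otimes>\<^bsub>additive_group\<^esub> x = \<one>\<^bsub>additive_group\<^esub>"
    by (intro bexI[of _ "- x"]) simp_all
qed (simp_all add: add.assoc)

lemma group_action_translation_action: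
  assumes "additive_poly q"
  shows "group_action additive_group (points affine_line) (translation_action q)"
proof -
  have q: "poly q (x + y) = poly q x + poly q y" for x y
    using assms unfolding additive_poly_def by simp
  have q0: "poly q 0 = 0"
    by (metis add.right_neutral add_left_cancel q)
  have qm: "poly q t + poly q (- t) = 0" for t
    using q[of t "- t"] q0 by simp
  have "bij_betw (translation_action q t) (points affine_line) (points affine_line)" for t
  proof (rule bij_betw_byWitness[where f' = "translation_action q (- t)"])
    show "\<forall>x\<in>points affine_line. translation_action q (- t) (translation_action q t x) = x"
      by (simp add: translation_action_def add.assoc qm line_point_eq)
    show "\<forall>x\<in>points affine_line. translation_action q t (translation_action q (- t) x) = x"
      using qm[of "- t"] by (simp add: translation_action_def add.assoc line_point_eq)
  qed (auto simp: translation_action_def)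
  then have bij: "translation_action q t \<in> Bij (points affine_line)" for t
    unfolding Bij_def by (simp add: translation_action_def)
  have "translation_action q (s + t) =
      compose (points affine_line) (translation_action q s) (translation_action q t)" for s t
    by (auto simp: translation_action_def compose_def q add_ac fun_eq_iff)
  with bij show ?thesis
    unfolding group_action_def group_hom_def group_hom_axioms_def
    by (intro conjI group_additive_group group_BijGroup) (auto simp: hom_def BijGroup_def)
qed

lemma is_G_variety_translation_action:
  assumes "infinite (UNIV :: 'k::field set)" "additive_poly q"
  shows "is_G_variety additive_group (affine_line :: (nat \<Rightarrow> 'k, 'k) fun_space) (translation_action q)"
  unfolding is_G_variety_def
proof (intro conjI is_variety_affine_line irreducible_affine_line group_action_translation_action assms)
  let ?P = "binary_product base_line (affine_line :: (nat \<Rightarrow> 'k, 'k) fun_space)"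
  note swf = locally_invertibleD(1)[OF locally_invertible_base_line] space_with_functions_affine_line
  have pts: "points ?P = points base_line \<times> points affine_line"
    by (rule points_binary_product[OF swf])
  have P: "locally_invertible ?P"
    by (rule locally_invertible_binary_product[OF swf])
  have o: "openin (zariski ?P) (points base_line \<times> points affine_line)"
    unfolding pts[symmetric] by (rule openin_topspace)
  \<comment> \<open>The coordinate of the moved point is a sum of one function from each
    factor.\<close>
  have reg: "(\<lambda>z. snd z 0 + poly q (fst z)) \<in> regular ?P (points base_line \<times> points affine_line)"
    by (rule regular_add[OF locally_invertibleD(1)[OF P] o
          regular_snd[OF swf regular_affine_line_coordinate] regular_fst[OF swf]])
      (simp add: regular_base_line_poly)
  have "is_morphism ?P affine_line (\<lambda>(g, x). translation_action q g x)"
  proof (rule is_morphism_affine_line[OF P])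
    show "(case z of (g, x) \<Rightarrow> translation_action q g x) \<in> points affine_line" if "z \<in> points ?P" for z
      using that unfolding pts by (auto simp: translation_action_def)
    show "(\<lambda>z. (case z of (g, x) \<Rightarrow> translation_action q g x) 0) \<in> regular ?P (points ?P)"
      unfolding pts
      by (rule regular_cong[OF locally_invertibleD(1)[OF P] o reg]) (auto simp: translation_action_def)
  qed
  then show "is_morphism (binary_product (group_space additive_group) affine_line) affine_line
      (\<lambda>(g, x). translation_action q g x)"
    unfolding group_space_additive_group .
qed

section \<open>Translations of affine space\<close>

abbreviation affine_power :: "'i set \<Rightarrow> ('i \<Rightarrow> nat \<Rightarrow> 'k::field, 'k) fun_space" where
  "affine_power J \<equiv> product_space J (\<lambda>_. affine_line)"

text \<open>The vector \<open>d\<close> is arbitrary. Group elements act by translations of this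
  kind, but the one that defeats separation does not come from the group.\<close>

definition translate :: "'i set \<Rightarrow> ('i \<Rightarrow> 'k::field) \<Rightarrow> ('i \<Rightarrow> nat \<Rightarrow> 'k) \<Rightarrow> 'i \<Rightarrow> nat \<Rightarrow> 'k" where
  "translate J d x = (\<lambda>i\<in>J. line_point (x i 0 + d i))"

lemma points_affine_power: "points (affine_power J) = (\<Pi>\<^sub>E i\<in>J. points affine_line)"
  by (rule points_product_space[OF space_with_functions_affine_line])

lemma locally_invertible_affine_power: "locally_invertible (affine_power J)"
  by (rule locally_invertible_product_space[OF space_with_functions_affine_line])

lemma points_affine_power_nonempty: "points (affine_power J) \<noteq> {}"
proof -
  have "(\<lambda>i\<in>J. line_point 0) \<in> points (affine_power J)"
    unfolding points_affine_power by simp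
  then show ?thesis by blast
qed

text \<open>Lines in the factors, run with a common parameter, give a line joining two points of the
  product.\<close>

lemma irreducible_affine_power:
  assumes "infinite (UNIV :: 'k::field set)" "finite J"
  shows "irreducible_space (affine_power J :: ('i \<Rightarrow> nat \<Rightarrow> 'k, 'k) fun_space)"
proof (rule irreducible_space_if_lines[OF assms(1) points_affine_power_nonempty])
  fix x y :: "'i \<Rightarrow> nat \<Rightarrow> 'k" assume x: "x \<in> points (affine_power J)" and y: "y \<in> points (affine_power J)"
  have "\<forall>i\<in>J. \<exists>h. is_morphism base_line affine_line h \<and> h 0 = x i \<and> h 1 = y i"
    using x y unfolding points_affine_power by (intro ballI affine_line_lines) auto
  then obtain h where h: "\<And>i. i \<in> J \<Longrightarrow> is_morphism base_line affine_line (h i)"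
    "\<And>i. i \<in> J \<Longrightarrow> h i 0 = x i" "\<And>i. i \<in> J \<Longrightarrow> h i 1 = y i"
    by metis
  have "is_morphism base_line (affine_power J) (\<lambda>s. \<lambda>i\<in>J. h i s)"
    by (rule is_morphism_product_space[OF assms(2) locally_invertible_base_line
          space_with_functions_affine_line h(1)])
  moreover have "(\<lambda>i\<in>J. h i 0) = x" "(\<lambda>i\<in>J. h i 1) = y"
    using x y h unfolding points_affine_power by (auto simp: fun_eq_iff PiE_iff extensional_def)
  ultimately show "\<exists>h. is_morphism base_line (affine_power J) h \<and> h 0 = x \<and> h 1 = y"
    by (intro exI[of _ "\<lambda>s. \<lambda>i\<in>J. h i s"] conjI)
qed

lemma is_morphism_translate:
  assumes "finite J"
  shows "is_morphism (affine_power J) (affine_power J) (translate J d)"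
proof -
  have "is_morphism (affine_power J) (affine_power J) (\<lambda>x. \<lambda>i\<in>J. line_point (x i 0 + d i))"
    by (rule is_morphism_product_space[OF assms locally_invertible_affine_power
          space_with_functions_affine_line is_morphism_comp[OF
            is_morphism_component[OF space_with_functions_affine_line] is_morphism_affine_line_shift]])
  then show ?thesis
    unfolding translate_def[abs_def] .
qed

lemma is_morphism_restrict:
  assumes "finite J" "I \<subseteq> J"
  shows "is_morphism (affine_power J) (affine_power I) (\<lambda>x. restrict x I)"
  by (rule is_morphism_product_space[OF finite_subset[OF assms(2,1)] locally_invertible_affine_power
        space_with_functions_affine_line is_morphism_component[OF space_with_functions_affine_line]])
    (use assms in blast)

lemma translate_in_points: "translate J d x \<in> points (affine_power J)"
  unfolding translate_def points_affine_power by simp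

lemma translate_translate: "translate J d (translate J e x) = translate J (\<lambda>i. e i + d i) x"
  unfolding translate_def by (auto simp: add.assoc)

lemma translate_zero: "x \<in> points (affine_power J) \<Longrightarrow> translate J (\<lambda>_. 0) x = x"
  unfolding translate_def points_affine_power by (auto simp: fun_eq_iff PiE_iff extensional_def line_point_eq)

text \<open>Ensures that preimages of nonempty open sets under a translation are nonempty;
  \<open>restrict_surj\<close> does the same for projections.\<close>

lemma translate_surj:
  assumes "y \<in> points (affine_power J)"
  obtains x where "x \<in> points (affine_power J)" "translate J d x = y"
proof
  show "translate J d (translate J (\<lambda>i. - d i) y) = y"
    unfolding translate_translate using translate_zero[OF assms] by simp
qed (rule translate_in_points)

lemma restrict_translate: "I \<subseteq> J \<Longrightarrow> restrict (translate J d x) I = translate I d (restrict x I)"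
  unfolding translate_def by (auto simp: fun_eq_iff)

lemma translate_cong: "(\<And>i. i \<in> J \<Longrightarrow> d i = e i) \<Longrightarrow> translate J d = translate J e"
  unfolding translate_def[abs_def] by (auto simp: fun_eq_iff)

lemma restrict_surj:
  assumes "y \<in> points (affine_power I)" "I \<subseteq> J"
  obtains x where "x \<in> points (affine_power J)" "restrict x I = y"
proof
  \<comment> \<open>The value 0 at the coordinates outside \<open>I\<close> is arbitrary.\<close>
  show "(\<lambda>i\<in>J. if i \<in> I then y i else line_point 0) \<in> points (affine_power J)"
    using assms unfolding points_affine_power by auto
  show "restrict (\<lambda>i\<in>J. if i \<in> I then y i else line_point 0) I = y"
    using assms unfolding points_affine_power by (auto simp: fun_eq_iff PiE_iff extensional_def)
qed

lemma diagonal_translation_action: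
  assumes "x \<in> points (affine_power J)"
  shows "diagonal_action J (\<lambda>_. affine_line) (\<lambda>i. translation_action (q i)) t x =
    translate J (\<lambda>i. poly (q i) t) x"
  using assms unfolding diagonal_action_def translate_def
  by (auto simp: points_affine_power translation_action_def fun_eq_iff)

lemma inv_additive_group [simp]: "inv\<^bsub>additive_group\<^esub> t = - (t :: 'k::field)"
proof -
  interpret group "additive_group :: ('k, 'k) alg_group" by (rule group_additive_group)
  show ?thesis
    by (rule inv_equality) simp_all
qed

section \<open>Invariants of subproducts under a translation\<close>

lemma rat_equivD:
  assumes "((U, f), (V, g)) \<in> rat_equiv Y"
  shows "openin (zariski Y) U" "U \<noteq> {}" "f \<in> regular Y U" "openin (zariski Y) V" "V \<noteq> {}"
    "g \<in> regular Y V" "\<And>x. x \<in> U \<Longrightarrow> x \<in> V \<Longrightarrow> f x = g x"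
  using assms unfolding rat_equiv_def rat_representatives_def by simp_all

text \<open>Invariance equates two classes and must be turned into an identity between values.
  \<open>V3\<close> is the domain of a representative of \<open>F\<close> whose pullback along
  \<open>t\<close> is equivalent to \<open>f0\<close>. It depends on \<open>t\<close>, and at the
  moved point it links that pullback with \<open>f0\<close> itself.\<close>

lemma invariant_representative:
  fixes q :: "'i \<Rightarrow> 'k::field poly"
  assumes "F \<in> invariant_rational_functions additive_group (affine_power I)
      (diagonal_action I (\<lambda>_. affine_line) (\<lambda>i. translation_action (q i)))"
  obtains V0 f0 V3 where "F = rat_equiv (affine_power I) `` {(V0, f0)}"
    "openin (zariski (affine_power I)) V0" "V0 \<noteq> {}"
    "openin (zariski (affine_power I)) V3" "V3 \<noteq> {}"
    "\<forall>v\<in>V0. translate I (\<lambda>i. poly (q i) t) v \<in> V0 \<inter> V3 \<longrightarrow>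
       f0 (translate I (\<lambda>i. poly (q i) t) v) = f0 v"
proof -
  let ?Y = "affine_power I :: ('i \<Rightarrow> nat \<Rightarrow> 'k, 'k) fun_space"
  let ?\<phi> = "diagonal_action I (\<lambda>_. affine_line) (\<lambda>i. translation_action (q i))"
  have F: "F \<in> rational_functions ?Y" and inv: "\<And>g. rat_pullback ?Y (?\<phi> (- g)) F = F"
    using assms unfolding invariant_rational_functions_def by simp_all
  obtain V0 f0 where V0: "(V0, f0) \<in> rat_representatives ?Y" "F = rat_equiv ?Y `` {(V0, f0)}"
    using F unfolding rational_functions_def by (auto elim: quotientE)
  have V0': "openin (zariski ?Y) V0" "V0 \<noteq> {}"
    using V0(1) unfolding rat_representatives_def by simp_all
  have "(V0, f0) \<in> F"
    using V0(1) unfolding V0(2) rat_equiv_def by simp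
  \<comment> \<open>The action on functions pulls back along the inverse, so invariance is used for
    the element \<open>- t\<close>.\<close>
  then have "(V0, f0) \<in> rat_pullback ?Y (?\<phi> t) F"
    using inv[of "- t"] by simp
  then obtain V3 f3 where V3: "(V3, f3) \<in> F"
    "(({x \<in> points ?Y. ?\<phi> t x \<in> V3}, \<lambda>x. f3 (?\<phi> t x)), (V0, f0)) \<in> rat_equiv ?Y"
    unfolding rat_pullback_def by auto
  have eq: "((V0, f0), (V3, f3)) \<in> rat_equiv ?Y"
    using V3(1) unfolding V0(2) by simp
  show thesis
  proof (rule that[OF V0(2) V0' rat_equivD(4,5)[OF eq]], intro ballI impI)
    fix v let ?w = "translate I (\<lambda>i. poly (q i) t) v"
    assume v: "v \<in> V0" "?w \<in> V0 \<inter> V3"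
    have pv: "v \<in> points ?Y"
      using v(1) openin_subset[OF V0'(1)] by blast
    have w: "?\<phi> t v = ?w"
      by (rule diagonal_translation_action[OF pv])
    have "f3 ?w = f0 v"
      using rat_equivD(7)[OF V3(2), of v] pv v w by simp
    moreover have "f0 ?w = f3 ?w"
      using rat_equivD(7)[OF eq, of ?w] v by simp
    ultimately show "f0 ?w = f0 v" by simp
  qed
qed

text \<open>On the coordinates in \<open>I\<close> the translation acts as the group element
  \<open>t\<close>, so it fixes a function pulled back from there. Two representatives are allowed
  because \<open>F\<close> may be defined at \<open>x\<close> and at its translate by different
  ones.\<close>

lemma subproduct_invariant_eq:
  fixes q :: "'i \<Rightarrow> 'k::field poly"
  assumes inf: "infinite (UNIV :: 'k set)" and J: "finite J" "I \<subseteq> J"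
    and F: "F \<in> subproduct_invariants additive_group J (\<lambda>_. affine_line) (\<lambda>i. translation_action (q i)) I"
    and U1: "(U1, f1) \<in> F" "x \<in> U1" and U2: "(U2, f2) \<in> F" "translate J d x \<in> U2"
    and d: "\<And>i. i \<in> I \<Longrightarrow> d i = poly (q i) t"
  shows "f1 x = f2 (translate J d x)"
proof -
  let ?X = "affine_power J :: ('i \<Rightarrow> nat \<Rightarrow> 'k, 'k) fun_space"
  let ?Y = "affine_power I :: ('i \<Rightarrow> nat \<Rightarrow> 'k, 'k) fun_space"
  let ?\<tau> = "translate J d"
  let ?res = "\<lambda>x :: 'i \<Rightarrow> nat \<Rightarrow> 'k. restrict x I"
  obtain F' where F': "F = rat_pullback ?X ?res F'"
    "F' \<in> invariant_rational_functions additive_group ?Y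
      (diagonal_action I (\<lambda>_. affine_line) (\<lambda>i. translation_action (q i)))"
    using F unfolding subproduct_invariants_def by blast
  obtain V0 f0 V3 where V0: "F' = rat_equiv ?Y `` {(V0, f0)}"
    "openin (zariski ?Y) V0" "V0 \<noteq> {}" "openin (zariski ?Y) V3" "V3 \<noteq> {}"
    and V3: "\<forall>v\<in>V0. translate I (\<lambda>i. poly (q i) t) v \<in> V0 \<inter> V3 \<longrightarrow>
       f0 (translate I (\<lambda>i. poly (q i) t) v) = f0 v"
    using invariant_representative[OF F'(2), of t] .
  obtain V1 f1' where V1: "(V1, f1') \<in> F'"
    "(({x \<in> points ?X. ?res x \<in> V1}, \<lambda>x. f1' (?res x)), (U1, f1)) \<in> rat_equiv ?X"
    using U1(1) unfolding F'(1) rat_pullback_def by auto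
  obtain V2 f2' where V2: "(V2, f2') \<in> F'"
    "(({x \<in> points ?X. ?res x \<in> V2}, \<lambda>x. f2' (?res x)), (U2, f2)) \<in> rat_equiv ?X"
    using U2(1) unfolding F'(1) rat_pullback_def by auto
  have e1: "((V0, f0), (V1, f1')) \<in> rat_equiv ?Y" and e2: "((V0, f0), (V2, f2')) \<in> rat_equiv ?Y"
    using V1(1) V2(1) unfolding V0(1) by simp_all
  note o1 = rat_equivD(4-6)[OF V1(2)] and o2 = rat_equivD(4-6)[OF V2(2)]
  have \<tau>: "is_morphism ?X ?X ?\<tau>"
    by (rule is_morphism_translate[OF J(1)])
  have X: "irreducible_space ?X" "locally_invertible ?X"
    by (rule irreducible_affine_power[OF inf J(1)] locally_invertible_affine_power)+
  note swf = locally_invertibleD(1)[OF X(2)]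
  define R where "R V = {x \<in> points ?X. ?res x \<in> V}" for V
  define T where "T V = {x \<in> points ?X. ?\<tau> x \<in> V}" for V
  have R: "openin (zariski ?X) (R V) \<and> R V \<noteq> {}" if V: "openin (zariski ?Y) V" "V \<noteq> {}" for V
  proof
    show "openin (zariski ?X) (R V)"
      unfolding R_def by (rule openin_morphism_preimage[OF is_morphism_restrict[OF J] V(1)])
    obtain y where y: "y \<in> V" using V(2) by blast
    then have "y \<in> points ?Y" using openin_subset[OF V(1)] by blast
    then obtain x where "x \<in> points ?X" "?res x = y"
      using restrict_surj[OF _ J(2)] by blast
    with y show "R V \<noteq> {}" unfolding R_def by blast
  qed
  have T: "openin (zariski ?X) (T V) \<and> T V \<noteq> {}" if V: "openin (zariski ?X) V" "V \<noteq> {}" for V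
  proof
    show "openin (zariski ?X) (T V)"
      unfolding T_def by (rule openin_morphism_preimage[OF \<tau> V(1)])
    obtain y where y: "y \<in> V" using V(2) by blast
    then have "y \<in> points ?X" using openin_subset[OF V(1)] by blast
    then obtain x where "x \<in> points ?X" "?\<tau> x = y"
      using translate_surj by blast
    with y show "T V \<noteq> {}" unfolding T_def by blast
  qed
  \<comment> \<open>At \<open>z\<close> in this set, \<open>R V0\<close> and \<open>R V1\<close>
    permit the comparison of \<open>f0\<close> with \<open>f1'\<close>. At the translate,
    \<open>V0\<close> and \<open>V2\<close> permit that with \<open>f2'\<close>, and
    \<open>V3\<close> gives the invariance of \<open>f0\<close>.\<close>
  define O' where "O' = R V0 \<inter> R V1 \<inter> T (R V0) \<inter> T (R V2) \<inter> T (R V3)"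
  note R0 = R[OF V0(2,3)] and R1 = R[OF rat_equivD(4,5)[OF e1]]
    and R2 = R[OF rat_equivD(4,5)[OF e2]] and R3 = R[OF V0(4,5)]
  note TR = T[OF conjunct1[OF R0] conjunct2[OF R0]] T[OF conjunct1[OF R2] conjunct2[OF R2]]
    T[OF conjunct1[OF R3] conjunct2[OF R3]]
  have RT: "openin (zariski ?X) U \<and> U \<noteq> {}"
    if "U \<in> {R V0, R V1, T (R V0), T (R V2), T (R V3)}" for U
    using that by (elim insertE emptyE) (simp_all only: R0 R1 TR simp_thms)
  have O': "openin (zariski ?X) O'"
    unfolding O'_def by (intro openin_Int) (simp_all only: R0 R1 TR)
  have "O' \<noteq> {}"
    using irreducible_space_Inter_nonempty[OF X(1) _ RT, of "{R V0, R V1, T (R V0), T (R V2), T (R V3)}"]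
    unfolding O'_def by auto
  \<comment> \<open>Both \<open>f1\<close> and the translated \<open>f2\<close> are regular here.
    The point \<open>x\<close> belongs to this set but perhaps not to \<open>O'\<close>, so the
    identity principle carries the equality over.\<close>
  let ?U = "U1 \<inter> T U2"
  have TU2: "openin (zariski ?X) (T U2)"
    using T[OF o2(1,2)] by blast
  have U: "openin (zariski ?X) ?U"
    by (rule openin_Int[OF o1(1) TU2])
  show ?thesis
  proof (rule regular_eq_if_eq_on_open[where f = f1 and g = "\<lambda>z. f2 (?\<tau> z)", OF X U _ _ _ O' \<open>O' \<noteq> {}\<close>])
    show "f1 \<in> regular ?X ?U"
      by (rule regular_mono[OF swf o1(1) U _ o1(3)]) blast
    show "(\<lambda>z. f2 (?\<tau> z)) \<in> regular ?X ?U"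
      by (rule regular_mono[OF swf TU2 U _ regular_morphism_preimage[OF \<tau> o2(1,3), folded T_def]]) blast
    show "x \<in> ?U"
      using U1(2) U2(2) openin_subset[OF o1(1)] unfolding T_def by blast
    fix z assume z: "z \<in> ?U \<inter> O'"
    have r: "?res (?\<tau> z) = translate I (\<lambda>i. poly (q i) t) (?res z)"
      unfolding restrict_translate[OF J(2)] using translate_cong[of I d, OF d] by simp
    have zR: "z \<in> points ?X" "?res z \<in> V0" "?res z \<in> V1" "?res (?\<tau> z) \<in> V0" "?res (?\<tau> z) \<in> V2"
      "?res (?\<tau> z) \<in> V3" "?\<tau> z \<in> points ?X" "z \<in> U1" "?\<tau> z \<in> U2"
      using z unfolding O'_def R_def T_def by auto
    have "f1 z = f1' (?res z)"
      using rat_equivD(7)[OF V1(2), of z] zR by simp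
    also have "\<dots> = f0 (?res z)"
      using rat_equivD(7)[OF e1, of "?res z"] zR by simp
    also have "\<dots> = f0 (?res (?\<tau> z))"
      using bspec[OF V3, of "?res z"] zR unfolding r by simp
    also have "\<dots> = f2' (?res (?\<tau> z))"
      using rat_equivD(7)[OF e2, of "?res (?\<tau> z)"] zR by simp
    also have "\<dots> = f2 (?\<tau> z)"
      using rat_equivD(7)[OF V2(2), of "?\<tau> z"] zR by simp
    finally show "f1 z = f2 (?\<tau> z)" .
  qed
qed

text \<open>The same equality shows that the descriptions in \<open>rat_value\<close> denote: every
  candidate value at one point equals a fixed value at the other, hence is unique.\<close>

lemma rat_value_subproduct_invariant_eq:
  fixes q :: "'i \<Rightarrow> 'k::field poly"
  assumes inf: "infinite (UNIV :: 'k set)" and J: "finite J" "I \<subseteq> J"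
    and F: "F \<in> subproduct_invariants additive_group J (\<lambda>_. affine_line) (\<lambda>i. translation_action (q i)) I"
    and x: "defined_at F x" "defined_at F (translate J d x)"
    and d: "\<And>i. i \<in> I \<Longrightarrow> d i = poly (q i) t"
  shows "rat_value F x = rat_value F (translate J d x)"
proof -
  obtain U1 f1 where 1: "(U1, f1) \<in> F" "x \<in> U1"
    using x(1) unfolding defined_at_def by blast
  obtain U2 f2 where 2: "(U2, f2) \<in> F" "translate J d x \<in> U2"
    using x(2) unfolding defined_at_def by blast
  note eq = subproduct_invariant_eq[OF inf J F _ _ _ _ d]
  have "rat_value F x = f2 (translate J d x)"
    unfolding rat_value_def
  proof (rule the_equality)
    show "\<exists>(U, f)\<in>F. x \<in> U \<and> f x = f2 (translate J d x)"
      by (rule bexI[OF _ 1(1)]) (simp add: 1(2) eq[OF 1 2])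
    fix c assume "\<exists>(U, f)\<in>F. x \<in> U \<and> f x = c"
    then obtain U f where "(U, f) \<in> F" "x \<in> U" "f x = c" by blast
    then show "c = f2 (translate J d x)"
      using eq[OF _ _ 2, of U f] by simp
  qed
  moreover have "rat_value F (translate J d x) = f1 x"
    unfolding rat_value_def
  proof (rule the_equality)
    show "\<exists>(U, f)\<in>F. translate J d x \<in> U \<and> f (translate J d x) = f1 x"
      by (rule bexI[OF _ 2(1)]) (simp add: 2(2) eq[OF 1 2])
    fix c assume "\<exists>(U, f)\<in>F. translate J d x \<in> U \<and> f (translate J d x) = c"
    then obtain U f where "(U, f) \<in> F" "translate J d x \<in> U" "f (translate J d x) = c" by blast
    then show "c = f1 x"
      using eq[OF 1, of U f] by simp
  qed
  ultimately show ?thesis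
    using eq[OF 1 2] by simp
qed

text \<open>The criterion behind the counterexample: \<open>d\<close> agrees with a group element on
  each coordinate set in the family, but with none on all of \<open>J\<close>.\<close>

lemma not_separates_orbits_in_general_position:
  fixes q :: "'i \<Rightarrow> 'k::field poly"
  assumes inf: "infinite (UNIV :: 'k set)" and J: "finite J" and q: "\<And>i. i \<in> J \<Longrightarrow> additive_poly (q i)"
    and not_global: "\<And>t. \<exists>i\<in>J. d i \<noteq> poly (q i) t"
    and local: "\<And>I. I \<in> \<I> \<Longrightarrow> I \<subseteq> J \<and> (\<exists>t. \<forall>i\<in>I. d i = poly (q i) t)"
  shows "\<not> separates_orbits_in_general_position additive_group (affine_power J)
    (diagonal_action J (\<lambda>_. affine_line) (\<lambda>i. translation_action (q i)))
    (\<Union>I\<in>\<I>. subproduct_invariants additive_group J (\<lambda>_. affine_line) (\<lambda>i. translation_action (q i)) I)"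
    (is "\<not> separates_orbits_in_general_position _ ?X ?\<phi> ?S")
proof
  assume "separates_orbits_in_general_position additive_group ?X ?\<phi> ?S"
  then obtain U where U: "openin (zariski ?X) U" "(zariski ?X) closure_of U = points ?X"
    "separates_orbits_in additive_group ?\<phi> ?S U"
    unfolding separates_orbits_in_general_position_def by blast
  have "points ?X \<noteq> {}"
    by (rule points_affine_power_nonempty)
  then have "U \<noteq> {}"
    using U(2) by (metis closure_of_empty)
  \<comment> \<open>A point of \<open>U \<inter> U'\<close> lies in \<open>U\<close> together with
    its translate.\<close>
  define U' where "U' = {x \<in> points ?X. translate J d x \<in> U}"
  have U': "openin (zariski ?X) U'"
    unfolding U'_def by (rule openin_morphism_preimage[OF is_morphism_translate[OF J] U(1)])
  obtain y where y: "y \<in> U" using \<open>U \<noteq> {}\<close> by blast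
  then have "y \<in> points ?X" using openin_subset[OF U(1)] by blast
  then obtain x where "x \<in> points ?X" "translate J d x = y" by (rule translate_surj)
  with y have "U' \<noteq> {}" unfolding U'_def by blast
  then have "U \<inter> U' \<noteq> {}"
    by (rule irreducible_space_Int_nonempty[OF irreducible_affine_power[OF inf J] U(1) \<open>U \<noteq> {}\<close> U'])
  then obtain x where x: "x \<in> U" "x \<in> points ?X" "translate J d x \<in> U"
    unfolding U'_def by blast
  have act: "?\<phi> t z = translate J (\<lambda>i. poly (q i) t) z" if "z \<in> points ?X" for t z
    by (rule diagonal_translation_action[OF that])
  \<comment> \<open>The element 0 acts trivially, so the translate lies in its own orbit. The two
    orbits then differ once the translate is shown to lie outside the orbit of
    \<open>x\<close>.\<close>
  have "poly (q i) 0 = 0" if "i \<in> J" for i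
    using q[OF that] unfolding additive_poly_def by (metis add.right_neutral add_left_cancel)
  then have "translate J (\<lambda>i. poly (q i) 0) (translate J d x) = translate J (\<lambda>_. 0) (translate J d x)"
    using translate_cong[of J "\<lambda>i. poly (q i) 0" "\<lambda>_. 0"] by simp
  then have "?\<phi> 0 (translate J d x) = translate J d x"
    unfolding act[OF translate_in_points] by (simp add: translate_zero[OF translate_in_points])
  then have "translate J d x \<in> orbit additive_group ?\<phi> (translate J d x)"
    unfolding orbit_def carrier_additive_group by (metis (mono_tags, lifting) CollectI UNIV_I)
  moreover have "translate J d x \<notin> orbit additive_group ?\<phi> x"
  proof
    assume "translate J d x \<in> orbit additive_group ?\<phi> x"
    then obtain t where t: "translate J d x = translate J (\<lambda>i. poly (q i) t) x"
      unfolding orbit_def using act[OF x(2)] by auto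
    obtain i where i: "i \<in> J" "d i \<noteq> poly (q i) t" using not_global by blast
    have "translate J d x i 0 = translate J (\<lambda>i. poly (q i) t) x i 0" unfolding t ..
    then show False
      using i by (simp add: translate_def)
  qed
  ultimately have "orbit additive_group ?\<phi> x \<noteq> orbit additive_group ?\<phi> (translate J d x)" by blast
  then obtain F where F: "F \<in> ?S" "defined_at F x" "defined_at F (translate J d x)"
    "rat_value F x \<noteq> rat_value F (translate J d x)"
    using U(3) x(1,3) unfolding separates_orbits_in_def by blast
  then obtain I where I: "I \<in> \<I>"
    "F \<in> subproduct_invariants additive_group J (\<lambda>_. affine_line) (\<lambda>i. translation_action (q i)) I"
    by blast
  obtain t where "I \<subseteq> J" "\<And>i. i \<in> I \<Longrightarrow> d i = poly (q i) t"
    using local[OF I(1)] by blast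
  then show False
    using rat_value_subproduct_invariant_eq[OF inf J _ I(2) F(2,3)] F(4) by blast
qed

section \<open>Additive polynomials in positive characteristic\<close>

text \<open>Over a finite field the product of all \<open>X - a\<close>, increased by 1, has
  positive degree and yet the value 1 everywhere.\<close>

lemma infinite_UNIV_alg_closed: "infinite (UNIV :: 'k::alg_closed_field set)"
proof
  assume fin: "finite (UNIV :: 'k set)"
  define f :: "'k poly" where "f = (\<Prod>a\<in>UNIV. [:- a, 1:])"
  have "degree f = (\<Sum>a\<in>(UNIV :: 'k set). 1)"
    unfolding f_def by (subst degree_prod_eq_sum_degree) auto
  also have "\<dots> > 0"
    using fin by (simp add: finite_UNIV_card_ge_0)
  finally have "degree (f + 1) > 0"
    by (subst degree_add_eq_left) auto
  then obtain x where "poly (f + 1) x = 0"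
    using alg_closed_imp_poly_has_root by blast
  moreover have "poly f x = 0"
    unfolding f_def poly_prod using fin by (intro prod_zero) auto
  ultimately show False by simp
qed

lemma additive_poly_smult: "additive_poly f \<Longrightarrow> additive_poly (smult c f)"
  unfolding additive_poly_def by (simp add: distrib_left)

lemma additive_poly_diff: "additive_poly f \<Longrightarrow> additive_poly g \<Longrightarrow> additive_poly (f - g)"
  unfolding additive_poly_def by simp

lemma additive_poly_sum: "(\<And>i. i \<in> A \<Longrightarrow> additive_poly (f i)) \<Longrightarrow> additive_poly (\<Sum>i\<in>A. f i)"
  unfolding additive_poly_def by (simp add: poly_sum sum.distrib)

lemma additive_poly_Frobenius:
  assumes "prime CHAR('k::field)"
  shows "additive_poly (monom 1 (CHAR('k) ^ n) :: 'k poly)"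
  unfolding additive_poly_def by (simp add: poly_monom freshmans_dream'[OF assms])

text \<open>Induction in the manner of Gram-Schmidt: find a nonzero additive polynomial vanishing at
  all previous points, normalise it at a new point, and correct the previous polynomials
  there.\<close>

lemma additive_polys_dual_points:
  assumes "prime CHAR('k::field)" and "infinite (UNIV :: 'k set)"
  shows "\<exists>(l :: nat \<Rightarrow> 'k poly) b. (\<forall>i<n. additive_poly (l i)) \<and>
    (\<forall>i<n. \<forall>j<n. poly (l i) (b j) = of_bool (i = j))"
proof (induction n)
  case (Suc n)
  then obtain l :: "nat \<Rightarrow> 'k poly" and b where l: "\<And>i. i < n \<Longrightarrow> additive_poly (l i)"
    and lb: "\<And>i j. i < n \<Longrightarrow> j < n \<Longrightarrow> poly (l i) (b j) = of_bool (i = j)"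
    by blast
  \<comment> \<open>A power of the characteristic exceeds its exponent, so \<open>N\<close> exceeds
    every \<open>degree (l i)\<close>.\<close>
  define N where "N = CHAR('k) ^ (\<Sum>i<n. degree (l i))"
  \<comment> \<open>By duality the sum takes the value \<open>b j ^ N\<close> at \<open>b j\<close>,
    so \<open>f\<close> vanishes there. Its coefficient at \<open>N\<close> stays 1 because the
    \<open>l i\<close> have smaller degree.\<close>
  define f where "f = monom 1 N - (\<Sum>i<n. smult (b i ^ N) (l i))"
  have f: "additive_poly f"
    unfolding f_def N_def
    by (intro additive_poly_diff additive_poly_Frobenius assms(1) additive_poly_sum additive_poly_smult)
      (simp add: l)
  have "degree (l i) < N" if "i < n" for i
  proof -
    have "degree (l i) \<le> (\<Sum>i<n. degree (l i))"
      using that by (intro member_le_sum) auto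
    also have "\<dots> < N"
      unfolding N_def using prime_gt_1_nat[OF assms(1)] by (intro power_gt_expt) simp
    finally show ?thesis .
  qed
  then have "coeff f N = 1"
    unfolding f_def by (simp add: coeff_sum coeff_eq_0)
  then have "f \<noteq> 0" by auto
  then obtain c where c: "poly f c \<noteq> 0"
    using poly_roots_finite[of f] assms(2) by (metis (mono_tags, lifting) UNIV_eq_I mem_Collect_eq)
  have fb: "poly f (b j) = 0" if "j < n" for j
    using that by (simp add: f_def poly_monom poly_sum lb sum.delta flip: of_bool_def)
  define g where "g = smult (1 / poly f c) f"
  have g: "additive_poly g" "poly g c = 1" "\<And>j. j < n \<Longrightarrow> poly g (b j) = 0"
    using c fb f by (auto simp: g_def intro: additive_poly_smult)
  show ?case
  proof (intro exI conjI allI impI)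
    \<comment> \<open>Subtracting a multiple of \<open>g\<close> makes \<open>l i\<close> vanish at
      \<open>c\<close> and leaves its values at the old points unchanged, since \<open>g\<close>
      vanishes at those.\<close>
    let ?l = "\<lambda>i. if i < n then l i - smult (poly (l i) c) g else g"
    let ?b = "\<lambda>j. if j < n then b j else c"
    show "additive_poly (?l i)" for i
      using l g(1) by (simp add: additive_poly_diff additive_poly_smult)
    show "poly (?l i) (?b j) = of_bool (i = j)" if "i < Suc n" "j < Suc n" for i j
      using that g lb by (auto simp: less_Suc_eq)
  qed
qed simp

section \<open>Arbitrarily large lower bounds for \<open>rho\<close>\<close>

lemma rho_additive_group_ge:
  assumes prime: "prime CHAR('k::field)" and inf: "infinite (UNIV :: 'k set)"
  shows "enat r \<le> rho (additive_group :: ('k, 'k) alg_group)"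
proof -
  obtain l :: "nat \<Rightarrow> 'k poly" and b where l: "\<And>i. i < r \<Longrightarrow> additive_poly (l i)"
    and lb: "\<And>i j. i < r \<Longrightarrow> j < r \<Longrightarrow> poly (l i) (b j) = of_bool (i = j)"
    using additive_polys_dual_points[OF assms, of r] by blast
  define J where "J = {1..Suc r}"
  \<comment> \<open>The polynomials \<open>l\<close> are numbered from 0 and the coordinates from 1,
    hence \<open>i - 1\<close>; coordinate \<open>Suc r\<close> carries the sum.\<close>
  define q where "q i = (if i \<le> r then l (i - 1) else \<Sum>j<r. l j)" for i
  define d :: "nat \<Rightarrow> 'k" where "d i = of_bool (i = Suc r)" for i
  have q: "additive_poly (q i)" if "i \<in> J" for i
    using that unfolding q_def J_def by (auto intro!: l additive_poly_sum)
  have not_global: "\<exists>i\<in>J. d i \<noteq> poly (q i) t" for t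
  proof (rule ccontr)
    assume "\<not> (\<exists>i\<in>J. d i \<noteq> poly (q i) t)"
    then have *: "poly (q i) t = d i" if "i \<in> J" for i using that by auto
    have "poly (l j) t = 0" if "j < r" for j
      using *[of "Suc j"] that by (simp add: q_def d_def J_def)
    moreover have "(\<Sum>j<r. poly (l j) t) = 1"
      using *[of "Suc r"] by (simp add: q_def d_def J_def poly_sum)
    ultimately show False by simp
  qed
  have local: "\<exists>t. \<forall>i\<in>I. d i = poly (q i) t" if I: "I \<subseteq> J" "card I \<le> r" for I
  proof -
    \<comment> \<open>\<open>J\<close> has \<open>r + 1\<close> elements, so \<open>I\<close> misses
      some \<open>k\<close>; the group element is chosen according to \<open>k\<close>.\<close>
    have "I \<noteq> J" using I(2) by (auto simp: J_def)
    then obtain k where k: "k \<in> J" "k \<notin> I" using I(1) by blast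
    show ?thesis
    proof (cases "k = Suc r")
      case True
      have "poly (q i) 0 = 0" if "i \<in> I" for i
        using q[of i] that I(1) unfolding additive_poly_def by (metis add.right_neutral add_left_cancel subsetD)
      then show ?thesis
        using k True by (intro exI[of _ 0]) (auto simp: d_def)
    next
      case False
      then have kr: "k - 1 < r" "1 \<le> k" using k by (auto simp: J_def)
      \<comment> \<open>Among the first \<open>r\<close> polynomials only the one at the missing
        coordinate \<open>k\<close> is nonzero at this dual point, while the sum has the value 1
        required at \<open>Suc r\<close>.\<close>
      have "d i = poly (q i) (b (k - 1))" if "i \<in> I" for i
      proof (cases "i = Suc r")
        case True
        then show ?thesis
          using kr by (simp add: d_def q_def poly_sum lb)
      next
        case False
        moreover have "i \<in> {1..Suc r}" using that I(1) unfolding J_def by blast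
        moreover have "i \<noteq> k" using that k(2) by blast
        ultimately have "i - 1 < r" "1 \<le> i" "i - 1 \<noteq> k - 1" using kr by auto
        then show ?thesis
          using kr \<open>i \<noteq> Suc r\<close> by (simp add: d_def q_def lb)
      qed
      then show ?thesis by blast
    qed
  qed
  let ?X = "\<lambda>_ :: nat. affine_line :: (nat \<Rightarrow> 'k, 'k) fun_space"
  let ?\<phi> = "\<lambda>i. translation_action (q i)"
  \<comment> \<open>For \<open>s < r\<close> every admissible subset falls under
    \<open>local\<close>, so separation fails. The bound then passes to the infimum.\<close>
  have "r \<le> s" if "separates_orbits_in_general_position additive_group (product_space {1..Suc r} ?X)
      (diagonal_action {1..Suc r} ?X ?\<phi>)
      (\<Union>I\<in>{I. I \<subseteq> {1..Suc r} \<and> card I \<le> s}. subproduct_invariants additive_group {1..Suc r} ?X ?\<phi> I)" for s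
  proof (rule ccontr)
    assume "\<not> r \<le> s"
    then have "I \<subseteq> J \<and> (\<exists>t. \<forall>i\<in>I. d i = poly (q i) t)" if "I \<in> {I. I \<subseteq> J \<and> card I \<le> s}" for I
      using that local by auto
    then show False
      using not_separates_orbits_in_general_position[OF inf _ q not_global, of "{I. I \<subseteq> J \<and> card I \<le> s}"] that
      unfolding J_def[symmetric] by (simp add: J_def)
  qed
  then have "enat r \<le> rho_product additive_group (Suc r) ?X ?\<phi>"
    unfolding rho_product_def by (intro Inf_greatest) auto
  also have "\<dots> \<le> rho (additive_group :: ('k, 'k) alg_group)"
    unfolding rho_def
  proof (rule Sup_upper, intro CollectI exI conjI refl ballI)
    fix i assume "i \<in> {1..Suc r}"
    then show "is_G_variety additive_group (?X i) (?\<phi> i)"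
      by (intro is_G_variety_translation_action inf q) (simp add: J_def)
  qed simp
  finally show ?thesis .
qed

theorem proposition4p3:
  fixes p :: nat
  assumes "CHAR('k::alg_closed_field) = p" and "p > 0"
  shows "rho (additive_group :: ('k, 'k) alg_group) = \<infinity>"
proof -
  have "prime CHAR('k)"
    using assms by (intro prime_CHAR_semidom) simp
  then have ge: "enat r \<le> rho (additive_group :: ('k, 'k) alg_group)" for r
    by (rule rho_additive_group_ge[OF _ infinite_UNIV_alg_closed])
  show ?thesis
  proof (cases "rho (additive_group :: ('k, 'k) alg_group)")
    case (enat n)
    then show ?thesis using ge[of "Suc n"] by simp
  qed simp
qed

end
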